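(* Assume the standing assumption, the strong pseudomonotonicity assumption, the state-Lipschitz assumption on $h$, the time regularity assumption and the Lipschitz assumption on $f$ stated in the context. Then the coupled problem is globally well-posed on $[0,T]$ in the sense of Hadamard. More specifically, for every initial datum $x_0\in H$ there exists a unique mild solution pair $(x,u)\in C([0,T];H)\times C([0,T];H)$; moreover, the solution map $\mathcal G:H\to C([0,T];H)\times C([0,T];H)$, $\mathcal G(x_0):=(x,u)$, is Lipschitz continuous: for any $x_{0,1},x_{0,2}\in H$, $$\|\mathcal G(x_{0,1})-\mathcal G(x_{0,2})\|_{C([0,T];H)\times C([0,T];H)}\le C_T\|x_{0,1}-x_{0,2}\|,\qquad C_T:=Me^{(\omega+M\tilde L)_+T}(1+L),$$ where $M\ge1$ and $\omega\in\mathbb R$ are constants with $\|e^{At}\|\le Me^{\omega t}$ for all $t\ge0$, $L:=\alpha_h\|P^{-1}\|/\gamma$ and $\tilde L:=\alpha_f+\beta_fL$.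
   Context: Let $H$ be a separable real Hilbert space with inner product $\langle\cdot,\cdot\rangle$ and norm $\|\cdot\|$, $\mathbb B_R(0)$ its closed ball of radius $R$ centered at $0$, and $T>0$. $\|v\|_{C([0,T];H)}:=\max_{t\in[0,T]}\|v(t)\|$, $\|(x,u)\|_{C([0,T];H)\times C([0,T];H)}:=\|x\|_{C([0,T];H)}+\|u\|_{C([0,T];H)}$, and $r_+:=\max\{r,0\}$. For nonempty closed convex $C\subset H$, $\mathrm{proj}_C$ is the metric projection onto $C$, and $N_C(y)=\{\xi\in H:\langle\xi,v-y\rangle\le0\ \forall v\in C\}$ if $y\in C$, $N_C(y)=\emptyset$ otherwise. A mapping $G:[0,T]\times X\to H$ ($X$ a separable metric space) is Carathéodory if $t\mapsto G(t,z)$ is strongly measurable for every $z\in X$, and $z\mapsto G(t,z)$ is continuous for almost every $t\in[0,T]$. Standing assumption: (i) $A:D(A)\subset H\to H$ is the infinitesimal generator of a strongly continuous semigroup $\{e^{At}\}_{t\ge0}$ on $H$; (ii) $P:H\to H$ is linear, bounded, self-adjoint and coercive (so $P$ is invertible with bounded inverse and $P^{-1}$ is strongly monotone); (iii) $K:[0,T]\rightrightarrows H$ is a set-valued mapping with nonempty, closed, convex values; (iv) $f,h:[0,T]\times H\times H\to H$ are Carathéodory mappings (with $X=H\times H$), and $t\mapsto f(t,0,0)$ belongs to $L^1(0,T;H)$. For $t\in[0,T]$, $x\in H$ define $F_{t,x}:H\to H$ by $F_{t,x}(y):=P^{-1}y-h(t,x,P^{-1}y)$. An operator $F:H\to H$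 is strongly pseudomonotone on $C\subset H$ with modulus $m>0$ if for all $y,z\in C$: $\langle F(y),z-y\rangle\ge0$ implies $\langle F(z),z-y\rangle\ge m\|z-y\|^2$. Strong pseudomonotonicity assumption: there are $\gamma>0$ and $L_F>0$ such that for every $t\in[0,T]$ and every $x\in H$, $F_{t,x}$ is strongly pseudomonotone on $K(t)$ with modulus $\gamma$ and Lipschitz continuous on $H$ with modulus $L_F$. State-Lipschitz assumption on $h$: there exists $\alpha_h>0$ such that $\|h(t,x_1,u)-h(t,x_2,u)\|\le\alpha_h\|x_1-x_2\|$ for all $t\in[0,T]$, $x_1,x_2,u\in H$. Time regularity assumption: (i) for every $R\ge0$ there is a continuous $\omega_{K,R}:\mathbb R_+\to\mathbb R_+$ with $\lim_{r\to0^+}\omega_{K,R}(r)=0$ and $\|\mathrm{proj}_{K(t_1)}(z)-\mathrm{proj}_{K(t_2)}(z)\|\le\omega_{K,R}(|t_1-t_2|)$ for all $t_1,t_2\in[0,T]$, $z\in\mathbb B_R(0)$; (ii) for every $R\ge0$ there is a continuous $\omega_{h,R}:\mathbb R_+\to\mathbb R_+$ with $\lim_{r\to0^+}\omega_{h,R}(r)=0$ and $\|h(t_1,x,u)-h(t_2,x,u)\|\le\omega_{h,R}(|t_1-t_2|)$ for all $t_1,t_2\in[0,T]$, $x,u\in\mathbb B_R(0)$. Lipschitz assumption on $f$: there are $\alpha_f>0$, $\beta_f>0$ such that $\|f(t,x_1,u_1)-f(t,x_2,u_2)\|\le\alpha_f\|x_1-x_2\|+\beta_f\|u_1-u_2\|$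 for all $t\in[0,T]$, $x_1,x_2,u_1,u_2\in H$. The coupled problem: given $x_0\in H$, find a mild solution pair, i.e. a pair $(x,u)\in C([0,T];H)\times C([0,T];H)$ with $x(t)=e^{At}x_0+\int_0^te^{A(t-s)}f(s,x(s),u(s))\,ds$ for all $t\in[0,T]$ and $u(t)\in h(t,x(t),u(t))-N_{K(t)}(Pu(t))$ for a.e. $t\in(0,T)$. *)

theory Defs
  imports "HOL-Analysis.Analysis" "HOL-Library.FuncSet"
begin

text \<open>
  A separable real Hilbert space is a type of sort
  \<open>{real_inner, banach, second_countable_topology}\<close>; for metric spaces, second countability
  and separability coincide.
\<close>

definition C0_semigroup :: "(real \<Rightarrow> 'a::real_normed_vector \<Rightarrow> 'a) \<Rightarrow> bool" where
  "C0_semigroup S \<longleftrightarrow>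
     (\<forall>t\<ge>0. bounded_linear (S t)) \<and> S 0 = id \<and>
     (\<forall>s\<ge>0. \<forall>t\<ge>0. S (s + t) = S s \<circ> S t) \<and>
     (\<forall>x. ((\<lambda>t. S t x) \<longlongrightarrow> x) (at_right 0))"

text \<open>The unbounded operator \<open>A\<close> is given by its domain \<open>D\<close> together with a function of which
  only the values on \<open>D\<close> matter.\<close>

definition infinitesimal_generator ::
    "'a set \<Rightarrow> ('a \<Rightarrow> 'a) \<Rightarrow> (real \<Rightarrow> 'a::real_normed_vector \<Rightarrow> 'a) \<Rightarrow> bool" where
  "infinitesimal_generator D A S \<longleftrightarrow>
     D = {x. \<exists>y. ((\<lambda>t. (S t x - x) /\<^sub>R t) \<longlongrightarrow> y) (at_right 0)} \<and>
     (\<forall>x\<in>D. ((\<lambda>t. (S t x - x) /\<^sub>R t) \<longlongrightarrow> A x) (at_right 0))"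

definition self_adjoint :: "('a::real_inner \<Rightarrow> 'a) \<Rightarrow> bool" where
  "self_adjoint P \<longleftrightarrow> (\<forall>x y. P x \<bullet> y = x \<bullet> P y)"

definition coercive :: "('a::real_inner \<Rightarrow> 'a) \<Rightarrow> bool" where
  "coercive P \<longleftrightarrow> (\<exists>c>0. \<forall>x. c * (norm x)\<^sup>2 \<le> P x \<bullet> x)"

text \<open>Not the library's \<open>closest_point\<close>, which is restricted to Heine-Borel spaces and hence
  to finite dimension.\<close>

definition metric_proj :: "'a::metric_space set \<Rightarrow> 'a \<Rightarrow> 'a" where
  "metric_proj C z = (THE p. p \<in> C \<and> (\<forall>y\<in>C. dist z p \<le> dist z y))"

definition normal_cone :: "'a::real_inner set \<Rightarrow> 'a \<Rightarrow> 'a set" where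
  "normal_cone C y = (if y \<in> C then {\<xi>. \<forall>v\<in>C. \<xi> \<bullet> (v - y) \<le> 0} else {})"

text \<open>Since the target space is separable, strong measurability on \<open>[0,T]\<close> is Lebesgue
  measurability.\<close>

definition caratheodory ::
    "real \<Rightarrow> (real \<Rightarrow> 'z::{metric_space, second_countable_topology} \<Rightarrow>
      'a::{real_normed_vector, second_countable_topology}) \<Rightarrow> bool" where
  "caratheodory T G \<longleftrightarrow>
     (\<forall>z. (\<lambda>t. G t z) \<in> borel_measurable (lebesgue_on {0..T})) \<and>
     (AE t in lebesgue_on {0..T}. continuous_on UNIV (G t))"

definition strongly_pseudomonotone_on ::
    "'a::real_inner set \<Rightarrow> ('a \<Rightarrow> 'a) \<Rightarrow> real \<Rightarrow> bool" where
  "strongly_pseudomonotone_on C F m \<longleftrightarrow>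
     (\<forall>y\<in>C. \<forall>z\<in>C. F y \<bullet> (z - y) \<ge> 0 \<longrightarrow> F z \<bullet> (z - y) \<ge> m * (norm (z - y))\<^sup>2)"

definition F_op ::
    "('a \<Rightarrow> 'a) \<Rightarrow> (real \<Rightarrow> 'a \<Rightarrow> 'a \<Rightarrow> 'a) \<Rightarrow> real \<Rightarrow> 'a \<Rightarrow> 'a \<Rightarrow> 'a::real_normed_vector" where
  "F_op P h t x y = inv P y - h t x (inv P y)"

definition modulus_fun :: "(real \<Rightarrow> real) \<Rightarrow> bool" where
  "modulus_fun w \<longleftrightarrow>
     continuous_on {0..} w \<and> (\<forall>r\<ge>0. w r \<ge> 0) \<and> (w \<longlongrightarrow> 0) (at_right 0)"

definition time_regular_K :: "real \<Rightarrow> (real \<Rightarrow> 'a::real_normed_vector set) \<Rightarrow> bool" where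
  "time_regular_K T K \<longleftrightarrow>
     (\<forall>R\<ge>0. \<exists>w. modulus_fun w \<and>
        (\<forall>t1\<in>{0..T}. \<forall>t2\<in>{0..T}. \<forall>z\<in>cball 0 R.
           norm (metric_proj (K t1) z - metric_proj (K t2) z) \<le> w \<bar>t1 - t2\<bar>))"

definition time_regular_h ::
    "real \<Rightarrow> (real \<Rightarrow> 'a \<Rightarrow> 'a \<Rightarrow> 'a::real_normed_vector) \<Rightarrow> bool" where
  "time_regular_h T h \<longleftrightarrow>
     (\<forall>R\<ge>0. \<exists>w. modulus_fun w \<and>
        (\<forall>t1\<in>{0..T}. \<forall>t2\<in>{0..T}. \<forall>x\<in>cball 0 R. \<forall>u\<in>cball 0 R.
           norm (h t1 x u - h t2 x u) \<le> w \<bar>t1 - t2\<bar>))"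

text \<open>Elements of \<open>C([0,T];H)\<close> are represented by functions on the real line that are
  \<open>undefined\<close> off \<open>[0,T]\<close>, so that equality of representatives is equality on \<open>[0,T]\<close>.\<close>

definition C_space :: "real \<Rightarrow> (real \<Rightarrow> 'a::real_normed_vector) set" where
  "C_space T = {v \<in> extensional {0..T}. continuous_on {0..T} v}"

text \<open>By compactness of \<open>[0,T]\<close> the supremum is a maximum for continuous \<open>v\<close>. Only values on
  \<open>[0,T]\<close> enter, so these norms also apply to pointwise differences of elements of
  \<open>C_space T\<close>.\<close>

definition C_norm :: "real \<Rightarrow> (real \<Rightarrow> 'a::real_normed_vector) \<Rightarrow> real" where
  "C_norm T v = (SUP t\<in>{0..T}. norm (v t))"

definition CC_norm ::
    "real \<Rightarrow> (real \<Rightarrow> 'a::real_normed_vector) \<times> (real \<Rightarrow> 'a) \<Rightarrow> real" where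
  "CC_norm T p = C_norm T (fst p) + C_norm T (snd p)"

text \<open>Integrability is required explicitly because the Bochner integral of a non-integrable
  function is \<open>0\<close> by convention.\<close>

definition mild_solution_pair ::
    "real \<Rightarrow> (real \<Rightarrow> 'a \<Rightarrow> 'a) \<Rightarrow> (real \<Rightarrow> 'a \<Rightarrow> 'a \<Rightarrow> 'a) \<Rightarrow> (real \<Rightarrow> 'a \<Rightarrow> 'a \<Rightarrow> 'a) \<Rightarrow>
     (real \<Rightarrow> 'a set) \<Rightarrow> ('a \<Rightarrow> 'a) \<Rightarrow> 'a::{real_inner, banach, second_countable_topology} \<Rightarrow>
     (real \<Rightarrow> 'a) \<times> (real \<Rightarrow> 'a) \<Rightarrow> bool" where
  "mild_solution_pair T S f h K P x0 p \<longleftrightarrow> (case p of (x, u) \<Rightarrow>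
     x \<in> C_space T \<and> u \<in> C_space T \<and>
     (\<forall>t\<in>{0..T}.
        set_integrable lebesgue {0..t} (\<lambda>s. S (t - s) (f s (x s) (u s))) \<and>
        x t = S t x0 + (LINT s:{0..t}|lebesgue. S (t - s) (f s (x s) (u s)))) \<and>
     (AE t in lebesgue_on {0<..<T}.
        u t \<in> {h t (x t) (u t) - \<xi> | \<xi>. \<xi> \<in> normal_cone (K t) (P (u t))}))"

text \<open>Below, \<open>Sol x0 p\<close> says that \<open>p\<close> solves the problem with datum \<open>x0\<close>, and \<open>N\<close> is the norm
  of the solution space.\<close>

definition solution_map :: "('a \<Rightarrow> 's \<Rightarrow> bool) \<Rightarrow> 'a \<Rightarrow> 's" where
  "solution_map Sol x0 = (THE p. Sol x0 p)"

definition hadamard_well_posed ::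
    "('a::real_normed_vector \<Rightarrow> 's::minus \<Rightarrow> bool) \<Rightarrow> ('s \<Rightarrow> real) \<Rightarrow> bool" where
  "hadamard_well_posed Sol N \<longleftrightarrow>
     (\<forall>x0. \<exists>!p. Sol x0 p) \<and>
     (\<forall>x0. \<forall>\<epsilon>>0. \<exists>\<delta>>0. \<forall>y0. norm (y0 - x0) < \<delta> \<longrightarrow>
        N (solution_map Sol y0 - solution_map Sol x0) < \<epsilon>)"

end

theory Submission
  imports Defs
begin

text \<open>
  For fixed \<open>(t, x)\<close> the inclusion for \<open>u\<close> says that \<open>y = P u\<close> solves the variational inequality
  on \<open>K t\<close> with operator \<open>F_op P h t x\<close>. For a strongly pseudomonotone operator \<open>F\<close> with modulus
  \<open>m\<close> the Minty sets \<open>{y. F v \<bullet> (v - y) \<ge> m * (norm (v - y))\<^sup>2}\<close> are closed balls with the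
  KKM property, so finitely many of them meet by Klee's theorem, which is proved by separation and
  needs no fixed point theorem. Minimal norm points then give a point common to countably many of
  them, hence by density to all, and this point solves the inequality.

  Testing strong pseudomonotonicity with the projection \<open>p\<close> of \<open>z - w\<close> onto the constraint set
  bounds the distance from \<open>p\<close> to the solution by \<open>(norm (F p - w) + norm (p - z)) / m\<close>. With
  \<open>z\<close> a solution for other data and \<open>w\<close> the value of its operator at \<open>z\<close>, this yields both the
  Lipschitz bound \<open>L\<close> in \<open>x\<close> and continuity in \<open>t\<close> of the solution \<open>U t x\<close>.

  The coupled problem is thereby reduced to the semilinear equation with the Lipschitz right-hand
  side \<open>f t x (U t x)\<close>, which is solved by Banach's fixed point theorem and compared for different
  initial data by Gronwall's inequality.
\<close>

section \<open>Closed convex sets in Hilbert spaces\<close>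

lemma infdist_less_obtains:
  assumes "infdist x A < r" "A \<noteq> {}"
  obtains a where "a \<in> A" "dist x a < r"
proof -
  have "(INF a\<in>A. dist x a) < r" using assms by (simp add: infdist_notempty)
  then show ?thesis using that assms(2) by (subst (asm) cINF_less_iff) auto
qed

text \<open>Stands in for weak compactness. The minimal norms \<open>d n\<close> increase to a
  finite \<open>s\<close>, and the slices of \<open>C n\<close> by balls with radii decreasing to
  \<open>s\<close> become arbitrarily small by the parallelogram law, so Cantor's intersection
  theorem applies. The norm bound lets a constant sequence produce minimal norm points.\<close>

lemma closed_convex_decreasing_nest:
  fixes C :: "nat \<Rightarrow> 'a::{real_inner, banach} set"
  assumes cl: "\<And>n. closed (C n)" and co: "\<And>n. convex (C n)" and ne: "\<And>n. C n \<noteq> {}"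
    and dec: "\<And>m n. m \<le> n \<Longrightarrow> C n \<subseteq> C m" and bdd: "bounded (C 0)"
  obtains a where "\<And>n. a \<in> C n" "\<And>n. norm a \<le> (SUP n. infdist 0 (C n))"
proof -
  define d where "d n = infdist 0 (C n)" for n
  define s where "s = (SUP n. d n)"
  \<comment> \<open>\<open>r n\<close> decreases to \<open>s\<close> but stays strictly above every
    \<open>d m\<close>, so no slice by \<open>cball 0 (r n)\<close> is empty.\<close>
  define r where "r n = s + inverse (real (Suc n))" for n
  obtain B where B: "\<And>x. x \<in> C 0 \<Longrightarrow> norm x \<le> B"
    using bdd unfolding bounded_iff by blast
  have d_le: "d n \<le> norm x" if "x \<in> C n" for n x
    using infdist_le[OF that, of 0] by (simp add: d_def)
  have "d n \<le> B" for n
    using ne[of n] d_le B dec[of 0 n] by (meson all_not_in_conv le0 order_trans subsetD)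
  then have bd: "bdd_above (range d)" by (auto intro!: bdd_aboveI2)
  have inc: "incseq d"
    unfolding incseq_def d_def using dec ne by (auto intro!: infdist_mono)
  have lim: "d \<longlonglongrightarrow> s" unfolding s_def by (rule LIMSEQ_incseq_SUP[OF bd inc])
  have ds: "d n \<le> s" for n unfolding s_def by (rule cSUP_upper[OF _ bd]) simp
  have d0: "0 \<le> d n" for n by (simp add: d_def infdist_nonneg)
  have s0: "0 \<le> s" using d0 ds order_trans by blast
  have r: "r \<longlonglongrightarrow> s"
    unfolding r_def using tendsto_add[OF tendsto_const LIMSEQ_inverse_real_of_nat, of s] by simp
  have r0: "s < r n" for n by (simp add: r_def)
  obtain a where a: "\<And>n. a \<in> C n \<inter> cball 0 (r n)"
  proof (rule decreasing_closed_nest[of "\<lambda>n. C n \<inter> cball 0 (r n)"])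
    show "closed (C n \<inter> cball 0 (r n))" for n using cl by auto
    show "C n \<inter> cball 0 (r n) \<noteq> {}" for n
    proof -
      have "infdist 0 (C n) < r n" using ds[of n] r0[of n] by (simp add: d_def)
      then obtain y where "y \<in> C n" "dist 0 y < r n"
        using infdist_less_obtains ne by blast
      then show ?thesis by force
    qed
    show "C n \<inter> cball 0 (r n) \<subseteq> C m \<inter> cball 0 (r m)" if "m \<le> n" for m n
    proof -
      have "r n \<le> r m" unfolding r_def using that by (intro add_left_mono le_imp_inverse_le) auto
      then show ?thesis using dec[OF that] by auto
    qed
    show "\<exists>n. \<forall>x\<in>C n \<inter> cball 0 (r n). \<forall>y\<in>C n \<inter> cball 0 (r n). dist x y < e" if "e > 0" for e
    proof -
      have "(\<lambda>n. 4 * (r n)\<^sup>2 - 4 * (d n)\<^sup>2) \<longlonglongrightarrow> 4 * s\<^sup>2 - 4 * s\<^sup>2"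
        by (intro tendsto_intros r lim)
      then have "\<forall>\<^sub>F n in sequentially. 4 * (r n)\<^sup>2 - 4 * (d n)\<^sup>2 < e\<^sup>2"
        by (rule order_tendstoD) (use that in auto)
      then obtain n where n: "4 * (r n)\<^sup>2 - 4 * (d n)\<^sup>2 < e\<^sup>2"
        by (auto simp: eventually_sequentially)
      have "dist x y < e" if x: "x \<in> C n" "norm x \<le> r n" and y: "y \<in> C n" "norm y \<le> r n" for x y
      proof -
        have "(1/2) *\<^sub>R x + (1/2) *\<^sub>R y \<in> C n"
          using co[of n] x(1) y(1) by (auto intro!: convexD)
        then have "d n \<le> norm ((1/2) *\<^sub>R x + (1/2) *\<^sub>R y)" by (rule d_le)
        then have "(d n)\<^sup>2 \<le> (norm ((1/2) *\<^sub>R x + (1/2) *\<^sub>R y))\<^sup>2" using d0 by (simp add: power_mono)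
        moreover have "(norm x)\<^sup>2 \<le> (r n)\<^sup>2" "(norm y)\<^sup>2 \<le> (r n)\<^sup>2"
          using x y by (simp_all add: power_mono)
        \<comment> \<open>Parallelogram law; the midpoint is in \<open>C n\<close> by convexity, so
          its norm is at least \<open>d n\<close>.\<close>
        moreover have "(norm (x - y))\<^sup>2 = 2 * (norm x)\<^sup>2 + 2 * (norm y)\<^sup>2
            - 4 * (norm ((1/2) *\<^sub>R x + (1/2) *\<^sub>R y))\<^sup>2"
          by (simp add: power2_norm_eq_inner inner_add inner_diff inner_commute algebra_simps)
        ultimately have "(norm (x - y))\<^sup>2 < e\<^sup>2" using n by linarith
        then show ?thesis using \<open>e > 0\<close> by (simp add: dist_norm power2_less_imp_less)
      qed
      then show ?thesis by (intro exI[of _ n]) auto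
    qed
  qed (use that in blast)
  have "norm a \<le> s"
    by (rule LIMSEQ_le_const[OF r]) (use a in auto)
  with a show ?thesis using that by (auto simp: s_def d_def)
qed

lemma closed_convex_nearest_point:
  fixes C :: "'a::{real_inner, banach} set"
  assumes "closed C" "convex C" "C \<noteq> {}"
  obtains p where "p \<in> C" "\<And>y. y \<in> C \<Longrightarrow> dist z p \<le> dist z y"
proof -
  define D where "D = (+) (- z) ` C"
  have D: "closed D" "convex D" "D \<noteq> {}"
    unfolding D_def using closed_translation[OF assms(1), of "- z"] convex_translation[OF assms(2), of "- z"] assms(3) by blast+
  define R where "R = infdist 0 D + 1"
  obtain q where q: "q \<in> D" "norm q < R"
    using infdist_less_obtains[of 0 D R] D unfolding R_def by auto
  \<comment> \<open>For a constant sequence the supremum is the distance from 0 to the slice;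
    slicing by a ball that meets \<open>D\<close> supplies boundedness.\<close>
  obtain a where a: "a \<in> D \<inter> cball 0 R" "norm a \<le> (SUP n::nat. infdist 0 (D \<inter> cball 0 R))"
  proof (rule closed_convex_decreasing_nest[of "\<lambda>_. D \<inter> cball 0 R"])
    show "D \<inter> cball 0 R \<noteq> {}" using q by force
  qed (use D that in \<open>auto intro: convex_Int closed_Int\<close>)
  have *: "norm a \<le> norm y" if "y \<in> D" for y
  proof (cases "norm y \<le> R")
    case True
    then show ?thesis using a infdist_le[of y "D \<inter> cball 0 R" 0] that by auto
  next
    case False
    then show ?thesis using a by auto
  qed
  obtain p where p: "p \<in> C" "a = - z + p" using a by (auto simp: D_def)
  have "dist z p \<le> dist z y" if "y \<in> C" for y
    using *[of "- z + y"] that p by (auto simp: D_def dist_norm norm_minus_commute)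
  with p that show ?thesis by blast
qed

lemma
  fixes C :: "'a::{real_inner, banach} set"
  assumes C: "closed C" "convex C" "C \<noteq> {}"
  shows metric_proj_in: "metric_proj C z \<in> C"
    and metric_proj_dot: "\<And>y. y \<in> C \<Longrightarrow> (z - metric_proj C z) \<bullet> (y - metric_proj C z) \<le> 0"
proof -
  obtain p where p: "p \<in> C" "\<And>y. y \<in> C \<Longrightarrow> dist z p \<le> dist z y"
    using closed_convex_nearest_point[OF C] by blast
  then have "metric_proj C z = p"
    unfolding metric_proj_def using any_closest_point_unique[OF C(2,1)] by (intro the_equality) auto
  with p any_closest_point_dot[OF C(2,1)]
  show "metric_proj C z \<in> C" "\<And>y. y \<in> C \<Longrightarrow> (z - metric_proj C z) \<bullet> (y - metric_proj C z) \<le> 0" by auto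
qed

text \<open>Adding the obtuse-angle inequalities of \<open>p\<close> and of the projection, each
  tested with the other point, gives \<open>(p - ?q) \<bullet> (p - ?q) \<le> 0\<close>.\<close>

lemma metric_proj_eqI:
  fixes C :: "'a::{real_inner, banach} set"
  assumes C: "closed C" "convex C" and p: "p \<in> C" "\<And>y. y \<in> C \<Longrightarrow> (z - p) \<bullet> (y - p) \<le> 0"
  shows "metric_proj C z = p"
proof -
  let ?q = "metric_proj C z"
  have "C \<noteq> {}" using p(1) by auto
  note q = metric_proj_in[OF C this, of z] metric_proj_dot[OF C this p(1), of z]
  have "(p - ?q) \<bullet> (p - ?q) = (z - ?q) \<bullet> (p - ?q) + (z - p) \<bullet> (?q - p)"
    by (simp add: inner_diff inner_commute algebra_simps)
  with q p(2)[OF q(1)] have "(p - ?q) \<bullet> (p - ?q) \<le> 0" by linarith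
  then show ?thesis by (metis inner_gt_zero_iff not_less right_minus_eq)
qed

section \<open>Separation, Klee's theorem and the KKM property\<close>

text \<open>A pair of nearest points \<open>p\<close>, \<open>q\<close> exists by compactness; the
  hyperplane normal to \<open>q - p\<close> through their midpoint separates strictly.\<close>

lemma strict_separation_compact_convex:
  fixes A B :: "'a::real_inner set"
  assumes A: "compact A" "convex A" "A \<noteq> {}" and B: "compact B" "convex B" "B \<noteq> {}"
    and AB: "A \<inter> B = {}"
  obtains a b where "\<And>x. x \<in> A \<Longrightarrow> a \<bullet> x < b" "\<And>y. y \<in> B \<Longrightarrow> b < a \<bullet> y"
proof -
  have "\<exists>z\<in>A \<times> B. \<forall>w\<in>A \<times> B. dist (fst z) (snd z) \<le> dist (fst w) (snd w)"
    by (rule continuous_attains_inf) (use A B in \<open>auto intro!: compact_Times continuous_intros\<close>)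
  then obtain p q where pq: "p \<in> A" "q \<in> B" and le: "\<And>x y. x \<in> A \<Longrightarrow> y \<in> B \<Longrightarrow> dist p q \<le> dist x y"
    by auto
  have 1: "(q - p) \<bullet> (x - p) \<le> 0" if "x \<in> A" for x
    using any_closest_point_dot[OF A(2) compact_imp_closed[OF A(1)] pq(1) that, of q] le pq by (simp add: dist_commute)
  have 2: "(p - q) \<bullet> (y - q) \<le> 0" if "y \<in> B" for y
    using any_closest_point_dot[OF B(2) compact_imp_closed[OF B(1)] pq(2) that, of p] le[OF pq(1)] by (metis dist_commute)
  have "p \<noteq> q" using pq AB by auto
  then have "0 < (q - p) \<bullet> (q - p)" by simp
  then have 3: "(q - p) \<bullet> p < (q - p) \<bullet> q" by (simp add: inner_diff)
  show ?thesis
  proof (rule that[of "q - p" "((q - p) \<bullet> p + (q - p) \<bullet> q) / 2"])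
    show "(q - p) \<bullet> x < ((q - p) \<bullet> p + (q - p) \<bullet> q) / 2" if "x \<in> A" for x
      using 1[OF that] 3 by (simp add: inner_diff_right field_simps)
    show "((q - p) \<bullet> p + (q - p) \<bullet> q) / 2 < (q - p) \<bullet> y" if "y \<in> B" for y
      using 2[OF that] 3 by (simp add: inner_diff_right inner_diff_left field_simps)
  qed
qed

lemma Klee_Inter_nonempty:
  fixes X :: "'i \<Rightarrow> 'a::real_inner set"
  assumes "finite I" "I \<noteq> {}" "\<And>i. i \<in> I \<Longrightarrow> compact (X i) \<and> convex (X i)"
    and "convex (\<Union>i\<in>I. X i)" "(\<Union>i\<in>I. X i) \<noteq> {}"
    and "\<And>j. j \<in> I \<Longrightarrow> (\<Inter>i\<in>I - {j}. X i) \<noteq> {}"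
  shows "(\<Inter>i\<in>I. X i) \<noteq> {}"
  using assms
proof (induction I arbitrary: X rule: finite_ne_induct)
  case (singleton i)
  then show ?case by auto
next
  case (insert n I)
  let ?A = "X n" and ?B = "\<Inter>i\<in>I. X i"
  show ?case
  proof
    assume "(\<Inter>i\<in>insert n I. X i) = {}"
    then have AB: "?A \<inter> ?B = {}" by auto
    have B: "compact ?B" "convex ?B" "?B \<noteq> {}"
    proof -
      obtain i where "i \<in> I" using insert.hyps by blast
      then have "?B = X i \<inter> ?B" by blast
      moreover have "closed ?B" using insert.prems(1) by (intro closed_INT) (simp add: compact_imp_closed)
      ultimately show "compact ?B" using insert.prems(1)[of i] \<open>i \<in> I\<close> compact_Int_closed by fastforce
      show "convex ?B" using insert.prems(1) by (auto intro: convex_INT)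
      show "?B \<noteq> {}" using insert.prems(4)[of n] insert.hyps by simp
    qed
    obtain j where "j \<in> I" using insert.hyps by blast
    with insert.prems(4)[of j] insert.hyps have A: "?A \<noteq> {}" by auto
    obtain a b where a: "\<And>x. x \<in> ?A \<Longrightarrow> a \<bullet> x < b" and b: "\<And>y. y \<in> ?B \<Longrightarrow> b < a \<bullet> y"
      using strict_separation_compact_convex[OF _ _ A B AB] insert.prems(1)[of n] by blast
    \<comment> \<open>The hyperplane misses \<open>X n\<close>, so its sections of the remaining sets satisfy the
      hypotheses again; but it also misses their intersection.\<close>
    let ?H = "{x. a \<bullet> x = b}"
    \<comment> \<open>A convex set is connected, so if it meets both sides of the hyperplane it
      meets the hyperplane.\<close>
    have cross: "\<exists>z\<in>Z. z \<in> ?H" if "convex Z" "x \<in> Z" "x \<in> ?A" "y \<in> Z" "y \<in> ?B" for Z x y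
      using connected_ivt_hyperplane[OF convex_connected[OF that(1)] that(2,4), of a b] a[OF that(3)] b[OF that(5)]
      by auto
    have "(\<Inter>i\<in>I. X i \<inter> ?H) \<noteq> {}"
    proof (rule insert.IH)
      show "compact (X i \<inter> ?H) \<and> convex (X i \<inter> ?H)" if "i \<in> I" for i
        using insert.prems(1) that by (auto intro!: compact_Int_closed closed_hyperplane convex_Int convex_hyperplane)
      have eq: "(\<Union>i\<in>I. X i \<inter> ?H) = (\<Union>i\<in>insert n I. X i) \<inter> ?H" using a by force
      show "convex (\<Union>i\<in>I. X i \<inter> ?H)"
        unfolding eq by (intro convex_Int insert.prems convex_hyperplane)
      obtain x y where "x \<in> ?A" "y \<in> ?B" using A B by blast
      moreover have "x \<in> (\<Union>i\<in>insert n I. X i)" "y \<in> (\<Union>i\<in>insert n I. X i)"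
        using calculation \<open>j \<in> I\<close> by auto
      ultimately show "(\<Union>i\<in>I. X i \<inter> ?H) \<noteq> {}"
        unfolding eq using cross[OF insert.prems(2)] by blast
      show "(\<Inter>i\<in>I - {k}. X i \<inter> ?H) \<noteq> {}" if k: "k \<in> I" for k
      proof -
        let ?Z = "\<Inter>i\<in>I - {k}. X i"
        have "k \<noteq> n" using k insert.hyps by auto
        then have "(\<Inter>i\<in>insert n I - {k}. X i) = ?A \<inter> ?Z" by auto
        then obtain x where "x \<in> ?A" "x \<in> ?Z" using insert.prems(4)[of k] k by fastforce
        moreover obtain y where "y \<in> ?B" using B by blast
        moreover have "convex ?Z" using insert.prems(1) by (auto intro: convex_INT)
        ultimately have "\<exists>z\<in>?Z. z \<in> ?H" using cross[of ?Z x y] by blast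
        then show ?thesis by auto
      qed
    qed
    then obtain z where z: "z \<in> (\<Inter>i\<in>I. X i \<inter> ?H)" by (meson ex_in_conv)
    then have "z \<in> ?B" "a \<bullet> z = b" using \<open>j \<in> I\<close> by blast+
    then show False using b by force
  qed
qed

text \<open>Klee's theorem applied inside the hull of \<open>V\<close>: the hull of finitely many
  points is compact, and induction on proper subsets supplies the common points of all sets but
  one.\<close>

lemma KKM_closed_convex:
  fixes B :: "'a::real_inner \<Rightarrow> 'a set"
  assumes "finite V" "V \<noteq> {}" "\<And>v. v \<in> V \<Longrightarrow> closed (B v) \<and> convex (B v)"
    and "\<And>W. W \<subseteq> V \<Longrightarrow> W \<noteq> {} \<Longrightarrow> convex hull W \<subseteq> (\<Union>w\<in>W. B w)"
  shows "convex hull V \<inter> (\<Inter>v\<in>V. B v) \<noteq> {}"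
  using assms
proof (induction V rule: finite_psubset_induct)
  case (psubset V)
  let ?X = "\<lambda>v. B v \<inter> convex hull V"
  \<comment> \<open>The KKM condition at \<open>W = V\<close> makes the union the whole hull, hence
    convex.\<close>
  have eq: "(\<Union>v\<in>V. ?X v) = convex hull V" using psubset.prems(3)[of V] psubset.prems(1) by blast
  have "(\<Inter>v\<in>V. ?X v) \<noteq> {}"
  proof (rule Klee_Inter_nonempty)
    show "compact (?X v) \<and> convex (?X v)" if "v \<in> V" for v
      using psubset.prems(2)[OF that] finite_imp_compact_convex_hull[OF psubset.hyps(1)]
      by (auto intro: convex_Int closed_Int_compact)
    show "convex (\<Union>v\<in>V. ?X v)" "(\<Union>v\<in>V. ?X v) \<noteq> {}" unfolding eq using psubset.prems(1) by auto
    show "(\<Inter>v\<in>V - {j}. ?X v) \<noteq> {}" if "j \<in> V" for j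
    proof (cases "V - {j} = {}")
      case False
      have "convex hull (V - {j}) \<inter> (\<Inter>v\<in>V - {j}. B v) \<noteq> {}"
      proof (rule psubset.IH)
        show "convex hull W \<subseteq> (\<Union>w\<in>W. B w)" if "W \<subseteq> V - {j}" "W \<noteq> {}" for W
          using psubset.prems(3)[of W] that by blast
      qed (use that False psubset.prems(2) in auto)
      moreover have "convex hull (V - {j}) \<subseteq> convex hull V" by (simp add: hull_mono)
      ultimately show ?thesis by blast
    qed auto
  qed (use psubset in auto)
  then show ?case using psubset.prems(1) by auto
qed

section \<open>Strongly pseudomonotone variational inequalities\<close>

definition vi_solution :: "'a::real_inner set \<Rightarrow> ('a \<Rightarrow> 'a) \<Rightarrow> 'a \<Rightarrow> bool" where
  "vi_solution C F y \<longleftrightarrow> y \<in> C \<and> (\<forall>v\<in>C. F y \<bullet> (v - y) \<ge> 0)"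

text \<open>Completing the square in \<open>y\<close>. The quadratic term turns the usual Minty
  half-space into a ball, which makes the Minty sets bounded as well as closed and convex.\<close>

lemma mem_cball_Minty_iff:
  fixes g v y :: "'a::real_inner"
  assumes "m > 0"
  shows "y \<in> cball (v - g /\<^sub>R (2 * m)) (norm g / (2 * m)) \<longleftrightarrow> g \<bullet> (v - y) \<ge> m * (norm (v - y))\<^sup>2"
proof -
  have "y \<in> cball (v - g /\<^sub>R (2 * m)) (norm g / (2 * m)) \<longleftrightarrow>
      norm (v - y - g /\<^sub>R (2 * m)) \<le> norm g / (2 * m)"
    by (simp add: dist_norm algebra_simps)
  also have "\<dots> \<longleftrightarrow> (norm (v - y - g /\<^sub>R (2 * m)))\<^sup>2 \<le> (norm g / (2 * m))\<^sup>2"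
    using assms by (intro power_mono_iff[symmetric]) auto
  also have "(norm (v - y - g /\<^sub>R (2 * m)))\<^sup>2
      = (norm (v - y))\<^sup>2 - (g \<bullet> (v - y)) / m + (norm g / (2 * m))\<^sup>2"
    using assms unfolding power2_norm_eq_inner power_divide
    by (simp add: inner_diff inner_commute power2_eq_square divide_simps) (simp add: algebra_simps)
  finally show ?thesis using assms by (simp add: field_simps)
qed

lemma vi_solution_exists:
  fixes C :: "'a::{real_inner, banach, second_countable_topology} set"
  assumes C: "closed C" "convex C" "C \<noteq> {}" and F: "continuous_on C F"
    and m: "m > 0" and ps: "strongly_pseudomonotone_on C F m"
  obtains y where "vi_solution C F y"
proof -
  define B where "B v = cball (v - F v /\<^sub>R (2 * m)) (norm (F v) / (2 * m))" for v
  have B: "y \<in> B v \<longleftrightarrow> F v \<bullet> (v - y) \<ge> m * (norm (v - y))\<^sup>2" for v y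
    unfolding B_def by (rule mem_cball_Minty_iff[OF m])
  have fip: "C \<inter> (\<Inter>v\<in>V. B v) \<noteq> {}" if V: "finite V" "V \<noteq> {}" "V \<subseteq> C" for V
  proof -
    have "convex hull V \<inter> (\<Inter>v\<in>V. B v) \<noteq> {}"
    proof (rule KKM_closed_convex[OF V(1,2)])
      show "closed (B v) \<and> convex (B v)" for v by (simp add: B_def)
      show "convex hull W \<subseteq> (\<Union>w\<in>W. B w)" if W: "W \<subseteq> V" "W \<noteq> {}" for W
      proof (rule subsetI, rule ccontr)
        fix y assume y: "y \<in> convex hull W" "y \<notin> (\<Union>w\<in>W. B w)"
        have "y \<in> C" using y(1) hull_minimal[of W C convex] C(2) W(1) V(3) by blast
        \<comment> \<open>If \<open>y\<close> is outside the ball of \<open>w\<close>, strong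
          pseudomonotonicity in contrapositive form puts \<open>w\<close> in this open half-space.
          It is convex, so it would contain \<open>y\<close> itself.\<close>
        have "W \<subseteq> {z. F y \<bullet> z < F y \<bullet> y}"
        proof
          fix w assume "w \<in> W"
          then have "w \<in> C" "\<not> F w \<bullet> (w - y) \<ge> m * (norm (w - y))\<^sup>2" using W V y(2) B by auto
          then have "\<not> F y \<bullet> (w - y) \<ge> 0"
            using ps \<open>y \<in> C\<close> unfolding strongly_pseudomonotone_on_def by blast
          then show "w \<in> {z. F y \<bullet> z < F y \<bullet> y}" by (simp add: inner_diff_right)
        qed
        then have "convex hull W \<subseteq> {z. F y \<bullet> z < F y \<bullet> y}"
          by (rule hull_minimal) (rule convex_halfspace_lt)
        with y(1) show False by auto
      qed
    qed
    moreover have "convex hull V \<subseteq> C" using V(3) C(2) by (simp add: hull_minimal)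
    ultimately show ?thesis by blast
  qed
  obtain D where D: "countable D" "D \<subseteq> C" "C \<subseteq> closure D" by (rule separable[of C])
  have "D \<noteq> {}" using C D by auto
  \<comment> \<open>An enumeration of a dense subset of \<open>C\<close>, so that the finite
    intersections form a decreasing sequence; repetitions are harmless.\<close>
  define e where "e = from_nat_into D"
  have e: "e n \<in> D" for n unfolding e_def by (rule from_nat_into[OF \<open>D \<noteq> {}\<close>])
  have range_e: "range e = D" unfolding e_def by (rule range_from_nat_into[OF \<open>D \<noteq> {}\<close> D(1)])
  obtain y where y: "\<And>n::nat. y \<in> C \<inter> (\<Inter>v\<in>e ` {..n}. B v)"
  proof (rule closed_convex_decreasing_nest[of "\<lambda>n. C \<inter> (\<Inter>v\<in>e ` {..n}. B v)"])
    show "closed (C \<inter> (\<Inter>v\<in>e ` {..n}. B v))" for n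
      by (intro closed_Int closed_INT C) (simp add: B_def)
    show "convex (C \<inter> (\<Inter>v\<in>e ` {..n}. B v))" for n
      by (intro convex_Int convex_INT C) (simp add: B_def)
    show "C \<inter> (\<Inter>v\<in>e ` {..n}. B v) \<noteq> {}" for n using e D by (intro fip) auto
    show "bounded (C \<inter> (\<Inter>v\<in>e ` {..0}. B v))" by (simp add: B_def bounded_Int)
  qed (auto dest: le_trans)
  have yC: "y \<in> C" using y by blast
  \<comment> \<open>The inequality holds along a sequence in \<open>D\<close> tending to
    \<open>v\<close> and passes to the limit because \<open>F\<close> is continuous on
    \<open>C\<close>.\<close>
  have yB: "F v \<bullet> (v - y) \<ge> 0" if vC: "v \<in> C" for v
  proof -
    obtain d where d: "\<And>n. d n \<in> D" "d \<longlonglongrightarrow> v"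
      using D(3) vC closure_sequential[of v D] by blast
    have "d n \<in> C" for n using d(1) D(2) by blast
    then have "(\<lambda>n. F (d n)) \<longlonglongrightarrow> F v"
      using continuous_on_tendsto_compose[OF F d(2) vC] by simp
    then have "(\<lambda>n. F (d n) \<bullet> (d n - y)) \<longlonglongrightarrow> F v \<bullet> (v - y)"
      by (intro tendsto_intros d)
    moreover have "F (d n) \<bullet> (d n - y) \<ge> 0" for n
    proof -
      obtain k where "d n = e k" using d(1)[of n] range_e by auto
      then have "y \<in> B (d n)" using y[of k] by auto
      then have "F (d n) \<bullet> (d n - y) \<ge> m * (norm (d n - y))\<^sup>2" using B by blast
      moreover have "m * (norm (d n - y))\<^sup>2 \<ge> 0" using m by simp
      ultimately show ?thesis by linarith
    qed
    ultimately show ?thesis by (intro LIMSEQ_le_const) auto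
  qed
  \<comment> \<open>Minty's argument: test with points \<open>z n\<close> of the segment from
    \<open>y\<close> to \<open>v\<close>, divide by the step \<open>s n\<close> and let it tend to
    0.\<close>
  have "F y \<bullet> (v - y) \<ge> 0" if vC: "v \<in> C" for v
  proof -
    define s where "s n = inverse (real (Suc n))" for n
    have s: "s n > 0" "s n \<le> 1" for n by (auto simp: s_def divide_simps)
    have s0: "s \<longlonglongrightarrow> 0" unfolding s_def by (rule LIMSEQ_inverse_real_of_nat)
    define z where "z n = y + s n *\<^sub>R (v - y)" for n
    have zC: "z n \<in> C" for n
    proof -
      have "(1 - s n) *\<^sub>R y + s n *\<^sub>R v \<in> C" using s[of n] yC vC C(2) by (intro convexD) auto
      then show ?thesis by (simp add: z_def algebra_simps)
    qed
    have "z \<longlonglongrightarrow> y + 0 *\<^sub>R (v - y)" unfolding z_def by (intro tendsto_intros s0)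
    then have "(\<lambda>n. F (z n)) \<longlonglongrightarrow> F y"
      using continuous_on_tendsto_compose[OF F _ yC, of z sequentially] zC by simp
    then have "(\<lambda>n. F (z n) \<bullet> (v - y)) \<longlonglongrightarrow> F y \<bullet> (v - y)" by (intro tendsto_intros)
    moreover have "F (z n) \<bullet> (v - y) \<ge> 0" for n
      using yB[OF zC[of n]] s(1)[of n] by (simp add: z_def zero_le_mult_iff)
    ultimately show ?thesis by (intro LIMSEQ_le_const) auto
  qed
  with yC that show ?thesis unfolding vi_solution_def by blast
qed

section \<open>Stability of variational inequalities\<close>

lemma vi_solution_fixed_point:
  fixes C :: "'a::{real_inner, banach} set"
  assumes "closed C" "convex C" "vi_solution C F y"
  shows "metric_proj C (y - F y) = y"
  using assms by (intro metric_proj_eqI) (auto simp: vi_solution_def)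

text \<open>\<open>z\<close> and \<open>w\<close> are arbitrary and may stem from a problem posed on
  another set. The projection lies in \<open>C\<close>, so pseudomonotonicity can compare it with
  \<open>y\<close>.\<close>

lemma vi_solution_perturbation:
  fixes C :: "'a::{real_inner, banach} set"
  assumes C: "closed C" "convex C" "C \<noteq> {}" and ps: "strongly_pseudomonotone_on C F m"
    and y: "vi_solution C F y"
  shows "m * norm (metric_proj C (z - w) - y)
    \<le> norm (F (metric_proj C (z - w)) - w) + norm (metric_proj C (z - w) - z)"
proof -
  let ?p = "metric_proj C (z - w)"
  have p: "?p \<in> C" "(z - w - ?p) \<bullet> (y - ?p) \<le> 0"
    using metric_proj_in[OF C] metric_proj_dot[OF C] y unfolding vi_solution_def by auto
  then have "m * (norm (?p - y))\<^sup>2 \<le> F ?p \<bullet> (?p - y)"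
    using ps y unfolding strongly_pseudomonotone_on_def vi_solution_def by blast
  \<comment> \<open>The added terms amount to \<open>(z - w - ?p) \<bullet> (?p - y)\<close>, which
    is nonnegative by the obtuse-angle property of the projection tested with
    \<open>y\<close>.\<close>
  also have "\<dots> \<le> (F ?p - w) \<bullet> (?p - y) + (?p - z) \<bullet> (y - ?p)"
    using p(2) by (simp add: inner_diff algebra_simps)
  also have "\<dots> \<le> norm (F ?p - w) * norm (?p - y) + norm (?p - z) * norm (?p - y)"
    by (intro add_mono norm_cauchy_schwarz) (metis norm_cauchy_schwarz norm_minus_commute)
  finally have "m * norm (?p - y) * norm (?p - y)
      \<le> (norm (F ?p - w) + norm (?p - z)) * norm (?p - y)"
    by (simp add: power2_eq_square algebra_simps)
  then show ?thesis by (cases "?p = y") (auto simp: add_nonneg_nonneg)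
qed

text \<open>For \<open>w = G z\<close> the projection of \<open>z - w\<close> onto \<open>C\<close>
  is \<open>z\<close> itself, so the second term of the perturbation bound vanishes.\<close>

lemma vi_solution_stability:
  fixes C :: "'a::{real_inner, banach} set"
  assumes C: "closed C" "convex C" and ps: "strongly_pseudomonotone_on C F m"
    and y: "vi_solution C F y" and z: "vi_solution C G z"
  shows "m * norm (z - y) \<le> norm (F z - G z)"
proof -
  have "C \<noteq> {}" using y by (auto simp: vi_solution_def)
  from vi_solution_perturbation[OF C this ps y, of z "G z"] vi_solution_fixed_point[OF C z]
  show ?thesis by simp
qed

lemma vi_solution_unique:
  fixes C :: "'a::{real_inner, banach} set"
  assumes "closed C" "convex C" "strongly_pseudomonotone_on C F m" "m > 0"
    and "vi_solution C F y" "vi_solution C F z"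
  shows "z = y"
  using vi_solution_stability[OF assms(1,2,3,5,6)] assms(4) by (simp add: mult_le_0_iff)

section \<open>Invertibility of coercive operators\<close>

text \<open>Lax-Milgram: coercivity and Cauchy-Schwarz bound \<open>P\<close> from below, which
  gives injectivity and the bound \<open>1 / c\<close> for the inverse; surjectivity comes from a
  contraction.\<close>

lemma coercive_bij:
  fixes P :: "'a::{real_inner, banach} \<Rightarrow> 'a"
  assumes P: "bounded_linear P" "coercive P"
  shows "bij P" and "bounded_linear (inv P)"
proof -
  interpret P: bounded_linear P by fact
  obtain c where c: "c > 0" "\<And>x. c * (norm x)\<^sup>2 \<le> P x \<bullet> x" using P(2) by (auto simp: coercive_def)
  obtain b where b: "b > 0" "\<And>x. norm (P x) \<le> norm x * b" using P.pos_bounded by blast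
  have low: "c * norm x \<le> norm (P x)" for x
  proof (cases "x = 0")
    case False
    have "c * (norm x)\<^sup>2 \<le> norm (P x) * norm x"
      using c(2)[of x] norm_cauchy_schwarz[of "P x" x] by linarith
    then show ?thesis using False by (simp add: power2_eq_square)
  qed simp
  have inj: "inj P"
  proof (rule injI)
    fix x y assume "P x = P y"
    then have "c * norm (x - y) \<le> 0" using low[of "x - y"] by (simp add: P.diff)
    then show "x = y" using c(1) by (simp add: mult_le_0_iff)
  qed
  have surj: "surj P"
  proof -
    \<comment> \<open>\<open>P x = z\<close> is solved by the contraction \<open>x \<mapsto> x - r *\<^sub>R (P x - z)\<close>;
      \<open>r\<close> minimises its constant \<open>1 - 2 * r * c + r\<^sup>2 * b\<^sup>2\<close>.\<close>
    define k where "k = 1 - c\<^sup>2 / b\<^sup>2"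
    define r where "r = c / b\<^sup>2"
    have cb: "c * norm x \<le> b * norm x" for x :: 'a using low[of x] b(2)[of x] by (simp add: mult.commute)
    have step: "(norm (x - r *\<^sub>R P x))\<^sup>2 \<le> k * (norm x)\<^sup>2" for x
    proof -
      have "(norm (x - r *\<^sub>R P x))\<^sup>2 = (norm x)\<^sup>2 - 2 * r * (P x \<bullet> x) + r\<^sup>2 * (norm (P x))\<^sup>2"
        by (simp add: power2_norm_eq_inner inner_diff inner_commute) (simp add: power2_eq_square algebra_simps)
      also have "\<dots> \<le> (norm x)\<^sup>2 - 2 * r * (c * (norm x)\<^sup>2) + r\<^sup>2 * (norm x * b)\<^sup>2"
        using c b(1) power_mono[OF b(2)[of x], of 2]
        by (intro add_mono diff_mono mult_left_mono) (auto simp: r_def)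
      also have "\<dots> = k * (norm x)\<^sup>2"
        using b(1) by (simp add: k_def r_def power2_eq_square field_simps)
      finally show ?thesis .
    qed
    have "\<exists>x. P x = z" for z
    \<comment> \<open>A nonzero vector forces \<open>0 \<le> k\<close>, as the contraction constant
      \<open>sqrt k\<close> requires. On the trivial space 0 solves the equation.\<close>
    proof (cases "\<exists>x::'a. x \<noteq> 0")
      case True
      then obtain x0 :: 'a where "x0 \<noteq> 0" by blast
      have k: "0 \<le> k" "k < 1"
      proof -
        have "0 \<le> k * (norm x0)\<^sup>2" using step[of x0] zero_le_power2 order_trans by blast
        then show "0 \<le> k" using \<open>x0 \<noteq> 0\<close> by (simp add: zero_le_mult_iff)
        show "k < 1" using c b by (simp add: k_def)
      qed
      have "\<exists>!x. x - r *\<^sub>R (P x - z) = x"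
      proof (rule banach_fix_type[of "sqrt k"])
        show "\<forall>x y. dist (x - r *\<^sub>R (P x - z)) (y - r *\<^sub>R (P y - z)) \<le> sqrt k * dist x y"
        proof (intro allI)
          fix x y
          have "x - r *\<^sub>R (P x - z) - (y - r *\<^sub>R (P y - z)) = (x - y) - r *\<^sub>R P (x - y)"
            by (simp add: P.diff algebra_simps)
          moreover have "norm ((x - y) - r *\<^sub>R P (x - y)) \<le> sqrt (k * (norm (x - y))\<^sup>2)"
            using step[of "x - y"] by (rule real_le_rsqrt)
          ultimately show "dist (x - r *\<^sub>R (P x - z)) (y - r *\<^sub>R (P y - z)) \<le> sqrt k * dist x y"
            by (simp only: dist_norm real_sqrt_mult real_sqrt_abs abs_norm_cancel)
        qed
      qed (use k in auto)
      then obtain x where "x - r *\<^sub>R (P x - z) = x" by blast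
      then have "r *\<^sub>R (P x - z) = 0" by (metis diff_eq_eq add_cancel_right_right)
      moreover have "r \<noteq> 0" using b c by (simp add: r_def)
      ultimately show ?thesis by auto
    qed (auto intro: exI[of _ 0])
    then show ?thesis by (metis surj_def)
  qed
  show bij: "bij P" using inj surj by (simp add: bij_def)
  have PQ: "P (inv P y) = y" for y using surj by (simp add: surj_f_inv_f)
  have QP: "inv P (P y) = y" for y using inj by simp
  show "bounded_linear (inv P)"
  proof (rule bounded_linear_intro[of _ "1 / c"])
    show "inv P (x + y) = inv P x + inv P y" for x y by (metis PQ QP P.add)
    show "inv P (s *\<^sub>R x) = s *\<^sub>R inv P x" for s x by (metis PQ QP P.scaleR)
    show "norm (inv P x) \<le> norm x * (1 / c)" for x
      using low[of "inv P x"] c(1) by (simp add: PQ field_simps)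
  qed
qed

section \<open>The control as a function of time and state\<close>

text \<open>Continuity on the closed half-line forces \<open>w 0 = 0\<close>, so sequences that hit
  0 are covered as well.\<close>

lemma modulus_fun_tendsto_zero:
  assumes w: "modulus_fun w" and s: "s \<longlonglongrightarrow> 0" "\<And>n. s n \<ge> 0"
  shows "(\<lambda>n. w (s n)) \<longlonglongrightarrow> 0"
proof -
  have c: "continuous_on {0..} w" and l: "(w \<longlongrightarrow> 0) (at_right 0)" using w by (auto simp: modulus_fun_def)
  have "(w \<longlongrightarrow> w 0) (at 0 within {0..})" using c by (simp add: continuous_on)
  then have "(w \<longlongrightarrow> w 0) (at_right 0)" by (rule tendsto_within_subset) auto
  then have "w 0 = 0" using l tendsto_unique trivial_limit_at_right_real by blast
  then show ?thesis using continuous_on_tendsto_compose[OF c s(1)] s(2) by auto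
qed

locale parametric_vi =
  fixes T :: real
    and P :: "'a::{real_inner, banach, second_countable_topology} \<Rightarrow> 'a"
    and K :: "real \<Rightarrow> 'a set"
    and h :: "real \<Rightarrow> 'a \<Rightarrow> 'a \<Rightarrow> 'a"
    and m L\<^sub>F \<alpha>\<^sub>h :: real
  assumes P: "bounded_linear P" "coercive P"
    and K: "\<And>t. t \<in> {0..T} \<Longrightarrow> K t \<noteq> {} \<and> closed (K t) \<and> convex (K t)"
    and m_pos: "m > 0"
    and F_pseudo: "\<And>t x. t \<in> {0..T} \<Longrightarrow> strongly_pseudomonotone_on (K t) (F_op P h t x) m"
    and F_lip: "\<And>t x. t \<in> {0..T} \<Longrightarrow> L\<^sub>F-lipschitz_on UNIV (F_op P h t x)"
    and \<alpha>\<^sub>h_pos: "\<alpha>\<^sub>h > 0"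
    and h_lip: "\<And>t x\<^sub>1 x\<^sub>2 u. t \<in> {0..T} \<Longrightarrow>
                  norm (h t x\<^sub>1 u - h t x\<^sub>2 u) \<le> \<alpha>\<^sub>h * norm (x\<^sub>1 - x\<^sub>2)"
    and K_time: "time_regular_K T K"
    and h_time: "time_regular_h T h"
begin

text \<open>The variational inequality lives in the variable \<open>y = P u\<close>;
  \<open>inv P\<close> returns to the control that the state \<open>x\<close> determines at time
  \<open>t\<close>.\<close>

definition U :: "real \<Rightarrow> 'a \<Rightarrow> 'a" where
  "U t x = inv P (THE y. vi_solution (K t) (F_op P h t x) y)"

lemma P_inv [simp]: "P (inv P y) = y" "inv P (P y) = y"
  using coercive_bij(1)[OF P] by (simp_all add: bij_def surj_f_inv_f)

lemma PU_solves:
  assumes t: "t \<in> {0..T}"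
  shows "vi_solution (K t) (F_op P h t x) (P (U t x))"
proof -
  have F: "continuous_on (K t) (F_op P h t x)"
    using lipschitz_on_continuous_on[OF F_lip[OF t]] by (rule continuous_on_subset) simp
  obtain y where y: "vi_solution (K t) (F_op P h t x) y"
    using vi_solution_exists[OF _ _ _ F m_pos F_pseudo[OF t]] K[OF t] by blast
  then have "\<exists>!y. vi_solution (K t) (F_op P h t x) y"
    using vi_solution_unique[OF _ _ F_pseudo[OF t] m_pos] K[OF t] by blast
  then show ?thesis unfolding U_def using theI' by simp
qed

text \<open>Since \<open>inv P (P u) = u\<close>, the vector \<open>h t x u - u\<close> is
  \<open>- F_op P h t x (P u)\<close>, and its membership in the normal cone is the variational
  inequality at \<open>P u\<close>.\<close>

lemma inclusion_iff:
  assumes t: "t \<in> {0..T}"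
  shows "u \<in> {h t x u - \<xi> | \<xi>. \<xi> \<in> normal_cone (K t) (P u)} \<longleftrightarrow> u = U t x"
proof -
  have "u = h t x u - \<xi> \<longleftrightarrow> \<xi> = h t x u - u" for \<xi>
    by (metis diff_diff_eq2 add_diff_cancel_left')
  then have "u \<in> {h t x u - \<xi> | \<xi>. \<xi> \<in> normal_cone (K t) (P u)}
      \<longleftrightarrow> h t x u - u \<in> normal_cone (K t) (P u)"
    by simp
  also have "\<dots> \<longleftrightarrow> vi_solution (K t) (F_op P h t x) (P u)"
    by (auto simp: normal_cone_def vi_solution_def F_op_def inner_diff_left)
  also have "\<dots> \<longleftrightarrow> u = U t x"
    using PU_solves[OF t, of x] vi_solution_unique[OF _ _ F_pseudo[OF t] m_pos] K[OF t]
    by (metis P_inv(2))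
  finally show ?thesis .
qed

text \<open>At a common point the operators for \<open>x\<close> and \<open>x'\<close> differ only
  through the state argument of \<open>h\<close>; stability divides by \<open>m\<close>, and
  \<open>inv P\<close> returns to the control.\<close>

lemma norm_U_diff_le:
  assumes t: "t \<in> {0..T}"
  shows "norm (U t x - U t x') \<le> \<alpha>\<^sub>h * onorm (inv P) / m * norm (x - x')"
proof -
  interpret Q: bounded_linear "inv P" using coercive_bij(2)[OF P] .
  have "m * norm (P (U t x) - P (U t x')) \<le>
      norm (F_op P h t x' (P (U t x)) - F_op P h t x (P (U t x)))"
    using vi_solution_stability[OF _ _ F_pseudo[OF t] PU_solves[OF t] PU_solves[OF t]] K[OF t] by blast
  also have "\<dots> \<le> \<alpha>\<^sub>h * norm (x - x')"
    using h_lip[OF t, of x "U t x" x'] by (simp add: F_op_def)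
  finally have *: "norm (P (U t x) - P (U t x')) \<le> \<alpha>\<^sub>h / m * norm (x - x')"
    using m_pos by (simp add: field_simps)
  have "norm (U t x - U t x') = norm (inv P (P (U t x) - P (U t x')))"
    by (simp add: Q.diff)
  also have "\<dots> \<le> onorm (inv P) * norm (P (U t x) - P (U t x'))"
    by (rule onorm[OF coercive_bij(2)[OF P]])
  also have "\<dots> \<le> onorm (inv P) * (\<alpha>\<^sub>h / m * norm (x - x'))"
    by (intro mult_left_mono * onorm_pos_le coercive_bij P)
  finally show ?thesis by (simp add: mult_ac)
qed

lemma continuous_on_U:
  assumes x: "continuous_on {0..T} x"
  shows "continuous_on {0..T} (\<lambda>t. U t (x t))"
  unfolding continuous_on_sequentially
proof (intro ballI allI impI)
  fix t s assume t: "t \<in> {0..T}" and "(\<forall>n. s n \<in> {0..T}) \<and> s \<longlonglongrightarrow> t"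
  then have s: "\<And>n. s n \<in> {0..T}" and lim: "s \<longlonglongrightarrow> t" by auto
  interpret Q: bounded_linear "inv P" using coercive_bij(2)[OF P] .
  define F where "F r = F_op P h r (x r)" for r
  define Y where "Y r = P (U r (x r))" for r
  define w where "w = F t (Y t)"
  \<comment> \<open>\<open>p\<close> compares the solution at \<open>s n\<close> with the one at \<open>t\<close> although only projections of fixed
    points onto \<open>K (s n)\<close> are controlled.\<close>
  define p where "p n = metric_proj (K (s n)) (Y t - w)" for n
  have sol: "vi_solution (K r) (F r) (Y r)" if "r \<in> {0..T}" for r
    unfolding F_def Y_def by (rule PU_solves[OF that])
  have dist0: "(\<lambda>n. \<bar>s n - t\<bar>) \<longlonglongrightarrow> 0"
    using lim by (simp add: LIM_zero tendsto_rabs_zero)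
  have p_lim: "(\<lambda>n. norm (p n - Y t)) \<longlonglongrightarrow> 0"
  proof -
    have "norm (Y t - w) \<ge> 0" by simp
    then obtain wK where wK: "modulus_fun wK" and le: "\<And>t1 t2. t1 \<in> {0..T} \<Longrightarrow> t2 \<in> {0..T} \<Longrightarrow>
        norm (metric_proj (K t1) (Y t - w) - metric_proj (K t2) (Y t - w)) \<le> wK \<bar>t1 - t2\<bar>"
      using K_time unfolding time_regular_K_def
      by (metis mem_cball_0 order_refl)
    \<comment> \<open>This identifies the limit of \<open>p\<close>: time regularity of
      \<open>K\<close> is applied at the single point \<open>Y t - w\<close>.\<close>
    have "metric_proj (K t) (Y t - w) = Y t"
      unfolding w_def using vi_solution_fixed_point[OF _ _ sol[OF t]] K[OF t] by blast
    then have "norm (p n - Y t) \<le> wK \<bar>s n - t\<bar>" for n using le[OF s[of n] t] by (simp add: p_def)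
    then show ?thesis
      by (intro tendsto_norm_zero Lim_null_comparison[OF _ modulus_fun_tendsto_zero[OF wK dist0]]) auto
  qed
  have F_lim: "(\<lambda>n. norm (F (s n) (Y t) - w)) \<longlonglongrightarrow> 0"
  proof -
    define R where "R = max (norm (x t)) (norm (U t (x t)))"
    have R: "R \<ge> 0" "x t \<in> cball 0 R" "U t (x t) \<in> cball 0 R" by (auto simp: R_def le_max_iff_disj)
    then obtain wh where wh: "modulus_fun wh" and le: "\<And>t1 t2. t1 \<in> {0..T} \<Longrightarrow> t2 \<in> {0..T} \<Longrightarrow>
        norm (h t1 (x t) (U t (x t)) - h t2 (x t) (U t (x t))) \<le> wh \<bar>t1 - t2\<bar>"
      using h_time unfolding time_regular_h_def by meson
    have "norm (F (s n) (Y t) - w) \<le> \<alpha>\<^sub>h * norm (x (s n) - x t) + wh \<bar>s n - t\<bar>" for n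
    proof -
      \<comment> \<open>First the state moves at the time \<open>s n\<close>, then the time moves
        with both arguments of \<open>h\<close> frozen; the second change is controlled by the
        modulus on the ball of radius \<open>R\<close>.\<close>
      have "F (s n) (Y t) - w = - (h (s n) (x (s n)) (U t (x t)) - h (s n) (x t) (U t (x t)))
          - (h (s n) (x t) (U t (x t)) - h t (x t) (U t (x t)))"
        by (simp add: F_def w_def Y_def F_op_def)
      then have "norm (F (s n) (Y t) - w) \<le> norm (h (s n) (x (s n)) (U t (x t)) - h (s n) (x t) (U t (x t)))
          + norm (h (s n) (x t) (U t (x t)) - h t (x t) (U t (x t)))"
        by (metis norm_minus_cancel norm_triangle_ineq4)
      also have "\<dots> \<le> \<alpha>\<^sub>h * norm (x (s n) - x t) + wh \<bar>s n - t\<bar>"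
        by (intro add_mono h_lip le s t)
      finally show ?thesis .
    qed
    moreover have "(\<lambda>n. \<alpha>\<^sub>h * norm (x (s n) - x t) + wh \<bar>s n - t\<bar>) \<longlonglongrightarrow> \<alpha>\<^sub>h * 0 + 0"
    proof (intro tendsto_intros modulus_fun_tendsto_zero[OF wh dist0])
      have "(\<lambda>n. x (s n)) \<longlonglongrightarrow> x t" by (rule continuous_on_tendsto_compose[OF x lim t]) (use s in auto)
      then show "(\<lambda>n. norm (x (s n) - x t)) \<longlonglongrightarrow> 0" by (simp add: LIM_zero tendsto_norm_zero)
    qed simp
    ultimately show ?thesis
      by (intro tendsto_norm_zero Lim_null_comparison[of "\<lambda>n. F (s n) (Y t) - w"]) auto
  qed
  \<comment> \<open>The perturbation estimate at time \<open>s n\<close>, with the argument of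
    \<open>F (s n)\<close> moved from \<open>p n\<close> to the fixed point \<open>Y t\<close> by
    the Lipschitz bound.\<close>
  have bound: "norm (Y (s n) - Y t) \<le>
      ((L\<^sub>F + 1) * norm (p n - Y t) + norm (F (s n) (Y t) - w)) / m + norm (p n - Y t)" for n
  proof -
    have "m * norm (p n - Y (s n)) \<le> norm (F (s n) (p n) - w) + norm (p n - Y t)"
      unfolding p_def
      using vi_solution_perturbation[OF _ _ _ F_pseudo[OF s] sol[OF s, unfolded F_def]] K[OF s]
      by (simp add: F_def)
    also have "norm (F (s n) (p n) - w) \<le> norm (F (s n) (p n) - F (s n) (Y t)) + norm (F (s n) (Y t) - w)"
      by (metis diff_add_cancel add_diff_eq norm_triangle_ineq)
    also have "norm (F (s n) (p n) - F (s n) (Y t)) \<le> L\<^sub>F * norm (p n - Y t)"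
      using lipschitz_onD[OF F_lip[OF s[of n]]] by (simp add: F_def dist_norm)
    finally have "norm (p n - Y (s n)) \<le> ((L\<^sub>F + 1) * norm (p n - Y t) + norm (F (s n) (Y t) - w)) / m"
      using m_pos by (simp add: field_simps)
    moreover have "norm (Y (s n) - Y t) \<le> norm (p n - Y (s n)) + norm (p n - Y t)"
      by (metis norm_minus_commute norm_triangle_sub add.commute diff_diff_eq2 norm_triangle_ineq4 diff_add_cancel)
    ultimately show ?thesis by linarith
  qed
  have "(\<lambda>n. ((L\<^sub>F + 1) * norm (p n - Y t) + norm (F (s n) (Y t) - w)) / m + norm (p n - Y t))
      \<longlonglongrightarrow> ((L\<^sub>F + 1) * 0 + 0) / m + 0"
    by (intro tendsto_intros p_lim F_lim) (use m_pos in auto)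
  then have "(\<lambda>n. Y (s n) - Y t) \<longlonglongrightarrow> 0"
    using bound by (intro Lim_null_comparison[of "\<lambda>n. Y (s n) - Y t"]) auto
  then have "(\<lambda>n. Y (s n)) \<longlonglongrightarrow> Y t" by (simp add: LIM_zero_iff)
  then have "(\<lambda>n. inv P (Y (s n))) \<longlonglongrightarrow> inv P (Y t)" by (rule Q.tendsto)
  then show "((\<lambda>t. U t (x t)) \<circ> s) \<longlonglongrightarrow> U t (x t)" by (simp add: Y_def o_def)
qed

end

section \<open>Operator semigroups, measurability and Gronwall's inequality\<close>

text \<open>Banach-Steinhaus: the closed sets \<open>V k\<close> cover a complete space, so by Baire
  one of them contains a ball.\<close>

lemma uniform_boundedness:
  fixes A :: "nat \<Rightarrow> 'a::banach \<Rightarrow> 'b::real_normed_vector"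
  assumes lin: "\<And>n. bounded_linear (A n)" and bdd: "\<And>x. bounded (range (\<lambda>n. A n x))"
  obtains B where "\<And>n x. norm (A n x) \<le> B * norm x"
proof -
  define V where "V k = {x. \<forall>n. norm (A n x) \<le> real k}" for k
  have cl: "closed (V k)" for k
  proof -
    have "continuous_on UNIV (A n)" for n by (rule linear_continuous_on[OF lin])
    then have "closed {x. norm (A n x) \<le> real k}" for n
      by (intro closed_Collect_le continuous_intros)
    then have "closed (\<Inter>n. {x. norm (A n x) \<le> real k})" by blast
    moreover have "V k = (\<Inter>n. {x. norm (A n x) \<le> real k})" by (auto simp: V_def)
    ultimately show ?thesis by simp
  qed
  have "x \<in> (\<Union>k. V k)" for x
  proof -
    obtain b where "\<And>n. norm (A n x) \<le> b" using bdd[of x] by (auto simp: bounded_iff)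
    moreover obtain k where "b \<le> real k" using real_arch_simple by blast
    ultimately show ?thesis by (auto simp: V_def intro: order_trans)
  qed
  then have UN: "(\<Union>k. V k) = UNIV" by blast
  have "\<exists>k. interior (V k) \<noteq> {}"
  proof (rule ccontr)
    assume "\<not> ?thesis"
    then have "euclidean interior_of \<Union>(range V) = {}"
      using cl by (intro Baire_category_alt) (auto simp: completely_metrizable_space_euclidean)
    then show False using UN by simp
  qed
  then obtain k x0 where "x0 \<in> interior (V k)" by blast
  then obtain r where r: "r > 0" "cball x0 r \<subseteq> V k" unfolding mem_interior_cball by blast
  have "norm (A n x) \<le> (2 * real k / r) * norm x" for n x
  proof (cases "x = 0")
    case True
    then show ?thesis using lin[of n] by (simp add: linear_simps)
  next
    case False
    \<comment> \<open>Rescaled to length \<open>r\<close>, so that \<open>x0 + ?y\<close> stays in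
      the ball; as a difference of two values bounded by \<open>k\<close>, \<open>A n ?y\<close> is
      bounded by twice \<open>k\<close>.\<close>
    let ?y = "(r / norm x) *\<^sub>R x"
    have "x0 + ?y \<in> cball x0 r" "x0 \<in> cball x0 r" using r(1) False by (auto simp: dist_norm)
    then have "norm (A n (x0 + ?y)) \<le> k" "norm (A n x0) \<le> k" using r(2) unfolding V_def by blast+
    then have "norm (A n (x0 + ?y) - A n x0) \<le> real k + real k"
      using norm_triangle_ineq4[of "A n (x0 + ?y)" "A n x0"] by linarith
    moreover have "A n ?y = A n (x0 + ?y) - A n x0" using lin[of n] by (simp add: linear_simps)
    ultimately have "norm (A n ?y) \<le> real k + real k" by simp
    moreover have "A n ?y = (r / norm x) *\<^sub>R A n x" using lin[of n] by (simp add: linear_simps)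
    ultimately show ?thesis using False r(1) by (simp add: field_simps)
  qed
  then show ?thesis by (rule that)
qed

text \<open>Times tending to 0 give convergent orbits, so uniform boundedness yields a bound on a
  short interval; the semigroup law extends it to \<open>[0,T]\<close> by powers.\<close>

lemma C0_semigroup_bounded:
  fixes S :: "real \<Rightarrow> 'a::banach \<Rightarrow> 'a"
  assumes S: "C0_semigroup S"
  obtains B where "B \<ge> 1" "\<And>t x. t \<in> {0..T} \<Longrightarrow> norm (S t x) \<le> B * norm x"
proof -
  have lin: "\<And>t. t \<ge> 0 \<Longrightarrow> bounded_linear (S t)" and S0: "S 0 = id"
    and add: "\<And>s t. s \<ge> 0 \<Longrightarrow> t \<ge> 0 \<Longrightarrow> S (s + t) = S s \<circ> S t"
    and lim: "\<And>x. ((\<lambda>t. S t x) \<longlongrightarrow> x) (at_right 0)"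
    using S by (auto simp: C0_semigroup_def)
  have "\<exists>n::nat. \<forall>t\<in>{0..inverse (real (Suc n))}. \<forall>x. norm (S t x) \<le> real n * norm x"
  proof (rule ccontr)
    assume "\<not> ?thesis"
    then obtain t y where t: "\<And>n. t n \<in> {0..inverse (real (Suc n))}"
      and y: "\<And>n. \<not> norm (S (t n) (y n)) \<le> real n * norm (y n)" by metis
    have "t \<longlonglongrightarrow> 0"
      by (rule tendsto_sandwich[OF _ _ tendsto_const LIMSEQ_inverse_real_of_nat]) (use t in auto)
    have "(\<lambda>n. S (t n) x) \<longlonglongrightarrow> x" for x
    proof -
      \<comment> \<open>\<open>t n\<close> may equal 0, so the right limit is restated as continuity
        at 0 within the closed half-line.\<close>
      have "((\<lambda>t. S t x) \<longlongrightarrow> S 0 x) (at 0 within {0..})"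
        using lim[of x] by (simp add: S0 at_within_Ici_at_right)
      then have "continuous (at 0 within {0..}) (\<lambda>t. S t x)" by (simp add: continuous_within)
      then show ?thesis
        using \<open>t \<longlonglongrightarrow> 0\<close> t S0 unfolding continuous_within_sequentially o_def by auto
    qed
    then have "bounded (range (\<lambda>n. S (t n) x))" for x by (rule convergent_imp_bounded)
    moreover have "bounded_linear (S (t n))" for n using lin t by auto
    ultimately obtain B where B: "\<And>n x. norm (S (t n) x) \<le> B * norm x"
      using uniform_boundedness[of "\<lambda>n. S (t n)"] by blast
    obtain n where "B \<le> real n" using real_arch_simple by blast
    then have "B * norm (y n) \<le> real n * norm (y n)" by (simp add: mult_right_mono)
    then show False using B[of n "y n"] y[of n] by linarith
  qed
  then obtain n :: nat where n: "\<And>t x. t \<in> {0..inverse (real (Suc n))} \<Longrightarrow> norm (S t x) \<le> real n * norm x"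
    by blast
  define d where "d = inverse (real (Suc n))"
  \<comment> \<open>The added 1 gives \<open>1 \<le> b\<close>, so powers of \<open>b\<close> do not
    decrease with the exponent and the final bound is at least 1.\<close>
  define b where "b = real n + 1"
  have d: "d > 0" and b: "b \<ge> 1" by (auto simp: d_def b_def)
  have Sb: "norm (S t x) \<le> b * norm x" if "t \<in> {0..d}" for t x
    using n[of t x] that norm_ge_zero[of x] unfolding d_def b_def distrib_right by linarith
  have *: "t \<in> {0..real k * d} \<Longrightarrow> norm (S t x) \<le> b ^ k * norm x" for k t x
  proof (induction k arbitrary: t)
    case 0
    then show ?case by (simp add: S0)
  next
    case (Suc k)
    show ?case
    proof (cases "t \<le> d")
      case True
      have "norm (S t x) \<le> b * norm x" using Sb True Suc by auto
      also have "\<dots> \<le> b ^ Suc k * norm x"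
        using b one_le_power[of b k] by (intro mult_right_mono) auto
      finally show ?thesis .
    next
      case False
      then have "S t = S d \<circ> S (t - d)" using add[of d "t - d"] d by simp
      then have "norm (S t x) \<le> b * norm (S (t - d) x)" using Sb[of d] d by simp
      also have "\<dots> \<le> b * (b ^ k * norm x)"
        using b False Suc.prems by (intro mult_left_mono Suc.IH) (auto simp: algebra_simps)
      finally show ?thesis by simp
    qed
  qed
  obtain k :: nat where "T / d \<le> real k" using real_arch_simple by blast
  then have "T \<le> real k * d" using d by (simp add: field_simps)
  then have "norm (S t x) \<le> b ^ k * norm x" if "t \<in> {0..T}" for t x using *[of t k] that by auto
  moreover have "b ^ k \<ge> 1" using b by simp
  ultimately show ?thesis using that by blast
qed

section \<open>Measurability of Caratheodory superpositions\<close>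

text \<open>Sampling \<open>z\<close> along a step function leaves countably many fixed second
  arguments, where measurability is given; continuity of \<open>G t\<close> then yields the
  pointwise limit.\<close>

lemma measurable_caratheodory_compose:
  fixes G :: "real \<Rightarrow> 'z::metric_space \<Rightarrow> 'b::metric_space"
  assumes meas: "\<And>z. (\<lambda>t. G t z) \<in> borel_measurable (lebesgue_on {0..T})"
    and cont: "\<And>t. t \<in> {0..T} \<Longrightarrow> continuous_on UNIV (G t)"
    and z: "continuous_on {0..T} z"
  shows "(\<lambda>t. G t (z t)) \<in> borel_measurable (lebesgue_on {0..T})"
proof (rule borel_measurable_LIMSEQ_metric)
  \<comment> \<open>Rounding down to multiples of \<open>1 / Suc n\<close> keeps
    \<open>r n t\<close> in \<open>[0,T]\<close>, where \<open>z\<close> is continuous.\<close>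
  define r where "r n t = of_int \<lfloor>real (Suc n) * t\<rfloor> / real (Suc n)" for n t
  show "(\<lambda>t. G t (z (r n t))) \<in> borel_measurable (lebesgue_on {0..T})" for n
    unfolding r_def
  proof (rule measurable_compose_countable[where f = "\<lambda>i t. G t (z (of_int i / real (Suc n)))"])
    have "(\<lambda>t. real (Suc n) * t) \<in> borel_measurable (lebesgue_on {0..T})"
      by (intro borel_measurable_times measurable_const measurable_restrict_space1 measurable_completion)
        (simp_all add: measurable_lborel1)
    then show "(\<lambda>t. \<lfloor>real (Suc n) * t\<rfloor>) \<in> measurable (lebesgue_on {0..T}) (count_space UNIV)"
      by (rule measurable_compose[OF _ measurable_real_floor])
  qed (rule meas)
  fix t assume "t \<in> space (lebesgue_on {0..T})"
  then have t: "t \<in> {0..T}" by simp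
  have r_ge: "t - inverse (real (Suc n)) \<le> r n t" and r_le: "r n t \<le> t" for n
  proof -
    have "real (Suc n) * t - 1 \<le> of_int \<lfloor>real (Suc n) * t\<rfloor>" by linarith
    then have "(real (Suc n) * t - 1) / real (Suc n) \<le> r n t" unfolding r_def by (rule divide_right_mono) simp
    then show "t - inverse (real (Suc n)) \<le> r n t" by (simp add: diff_divide_distrib inverse_eq_divide del: of_nat_Suc)
    have "of_int \<lfloor>real (Suc n) * t\<rfloor> \<le> real (Suc n) * t" by linarith
    then show "r n t \<le> t" by (simp add: r_def field_simps del: of_nat_Suc)
  qed
  have "r n t \<in> {0..T}" for n
    using t r_le[of n] by (auto simp: r_def intro: order_trans)
  moreover have "(\<lambda>n. r n t) \<longlonglongrightarrow> t"
  proof (rule tendsto_sandwich[OF _ _ _ tendsto_const])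
    show "(\<lambda>n. t - inverse (real (Suc n))) \<longlonglongrightarrow> t"
      using tendsto_diff[OF tendsto_const LIMSEQ_inverse_real_of_nat, of t] by simp
  qed (use r_ge r_le in auto)
  ultimately have "(\<lambda>n. z (r n t)) \<longlonglongrightarrow> z t"
    using continuous_on_tendsto_compose[OF z _ t, of "\<lambda>n. r n t" sequentially] by simp
  then show "(\<lambda>n. G t (z (r n t))) \<longlonglongrightarrow> G t (z t)"
    using continuous_on_tendsto_compose[OF cont[OF t]] by simp
qed

section \<open>Gronwall's inequality\<close>

text \<open>The majorant \<open>G\<close> has derivative \<open>k * g\<close>, which is at most
  \<open>k * G\<close>, so \<open>exp (- k * t) * G t\<close> is nonincreasing and starts at
  \<open>a\<close>.\<close>

lemma gronwall:
  fixes g :: "real \<Rightarrow> real"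
  assumes g: "continuous_on {0..T} g" and k: "k \<ge> 0"
    and le: "\<And>t. t \<in> {0..T} \<Longrightarrow> g t \<le> a + k * integral {0..t} g"
    and t: "t \<in> {0..T}"
  shows "g t \<le> a * exp (k * t)"
proof -
  define G where "G t = a + k * integral {0..t} g" for t
  define H where "H t = exp (- k * t) * G t" for t
  have cG: "continuous_on {0..T} G"
    unfolding G_def using integrable_continuous_interval[OF g]
    by (intro continuous_intros indefinite_integral_continuous_1)
  have "H t \<le> H 0"
  proof (rule DERIV_nonpos_imp_decreasing_open[of 0 t H])
    show "continuous_on {0..t} H"
      unfolding H_def by (intro continuous_intros continuous_on_subset[OF cG]) (use t in auto)
    fix x assume x: "0 < x" "x < t"
    then have x': "x \<in> {0..T}" using t by auto
    have "((\<lambda>x. integral {0..x} g) has_real_derivative g x) (at x within {0..T})"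
      by (rule integral_has_real_derivative[OF g x'])
    then have "((\<lambda>x. integral {0..x} g) has_real_derivative g x) (at x)"
      using x t at_within_Icc_at[of 0 x T] by simp
    then have "(H has_real_derivative (exp (- k * x) * (k * (g x - G x)))) (at x)"
      unfolding H_def G_def by (auto intro!: derivative_eq_intros simp: algebra_simps)
    moreover have "exp (- k * x) * (k * (g x - G x)) \<le> 0"
      using le[OF x'] k by (intro mult_nonneg_nonpos) (auto simp: G_def)
    ultimately show "\<exists>y. (H has_real_derivative y) (at x) \<and> y \<le> 0" by blast
  qed (use t in auto)
  then have "exp (- k * t) * G t \<le> a" by (simp add: H_def G_def)
  then have "G t \<le> a * exp (k * t)" by (simp add: exp_minus field_simps)
  then show ?thesis using le[OF t] by (simp add: G_def)
qed

section \<open>Semilinear evolution equations\<close>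

locale bounded_C0_semigroup =
  fixes S :: "real \<Rightarrow> 'a::{banach, second_countable_topology} \<Rightarrow> 'a" and T B :: real
  assumes C0: "C0_semigroup S"
    and T_nonneg: "T \<ge> 0" and B_nonneg: "B \<ge> 0"
    and bound: "\<And>t x. t \<in> {0..T} \<Longrightarrow> norm (S t x) \<le> B * norm x"
begin

lemma lin: "t \<ge> 0 \<Longrightarrow> bounded_linear (S t)" and S_zero: "S 0 x = x"
  and S_add: "s \<ge> 0 \<Longrightarrow> t \<ge> 0 \<Longrightarrow> S (s + t) x = S s (S t x)"
  using C0 by (simp_all add: C0_semigroup_def)

lemma S_diff: "t \<ge> 0 \<Longrightarrow> S t (x - y) = S t x - S t y"
  using lin by (simp add: linear_simps)

lemma continuous_on_orbit: "continuous_on {0..T} (\<lambda>t. S t x)"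
  unfolding continuous_on_sequentially
proof (intro ballI allI impI)
  fix t r assume t: "t \<in> {0..T}" and "(\<forall>n. r n \<in> {0..T}) \<and> r \<longlonglongrightarrow> t"
  then have r: "\<And>n. r n \<in> {0..T}" and lim: "r \<longlonglongrightarrow> t" by auto
  have "((\<lambda>t. S t x) \<longlongrightarrow> S 0 x) (at 0 within {0..})"
    using C0 by (simp add: C0_semigroup_def at_within_Ici_at_right)
  then have c: "continuous (at 0 within {0..}) (\<lambda>t. S t x)" by (simp add: continuous_within)
  have "(\<lambda>n. \<bar>r n - t\<bar>) \<longlonglongrightarrow> 0" using lim by (simp add: LIM_zero tendsto_rabs_zero)
  then have "(\<lambda>n. S \<bar>r n - t\<bar> x) \<longlonglongrightarrow> x"
    using c unfolding continuous_within_sequentially o_def by (auto simp: S_zero)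
  then have "(\<lambda>n. B * norm (S \<bar>r n - t\<bar> x - x)) \<longlonglongrightarrow> B * 0"
    by (intro tendsto_intros) (simp add: LIM_zero tendsto_norm_zero)
  moreover have "norm (S (r n) x - S t x) \<le> B * norm (S \<bar>r n - t\<bar> x - x)" for n
  proof -
    \<comment> \<open>Factoring out the smaller time reduces both one-sided limits to right
      continuity at 0.\<close>
    have *: "norm (S b x - S a x) \<le> B * norm (S (b - a) x - x)" if "a \<in> {0..T}" "a \<le> b" for a b
      using bound[OF that(1), of "S (b - a) x - x"] that S_add[of a "b - a" x] S_diff[of a] by simp
    show ?thesis
    proof (cases "t \<le> r n")
      case True
      then show ?thesis using *[OF t True] by simp
    next
      case False
      then show ?thesis using *[OF r[of n], of t] by (simp add: norm_minus_commute)
    qed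
  qed
  ultimately have "(\<lambda>n. S (r n) x - S t x) \<longlonglongrightarrow> 0"
    by (intro Lim_null_comparison[of "\<lambda>n. S (r n) x - S t x"]) auto
  then show "((\<lambda>t. S t x) \<circ> r) \<longlonglongrightarrow> S t x" by (simp add: LIM_zero_iff o_def)
qed

text \<open>The uniform bound \<open>B\<close> handles the moving vector, strong continuity the
  moving time.\<close>

lemma tendsto_S:
  assumes t: "t \<in> {0..T}" and r: "\<And>n. r n \<in> {0..T}" "r \<longlonglongrightarrow> t" and y: "y \<longlonglongrightarrow> x"
  shows "(\<lambda>n. S (r n) (y n)) \<longlonglongrightarrow> S t x"
proof -
  have "(\<lambda>n. B * norm (y n - x)) \<longlonglongrightarrow> B * 0"
    using y by (intro tendsto_intros) (simp add: LIM_zero tendsto_norm_zero)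
  moreover have "norm (S (r n) (y n) - S (r n) x) \<le> B * norm (y n - x)" for n
    using bound[OF r(1)] r(1)[of n] by (metis S_diff atLeastAtMost_iff)
  ultimately have "(\<lambda>n. S (r n) (y n) - S (r n) x) \<longlonglongrightarrow> 0"
    by (intro Lim_null_comparison[of "\<lambda>n. S (r n) (y n) - S (r n) x"]) auto
  moreover have "(\<lambda>n. S (r n) x) \<longlonglongrightarrow> S t x"
    using continuous_on_tendsto_compose[OF continuous_on_orbit r(2) t] r(1) by simp
  ultimately show ?thesis using tendsto_add by fastforce
qed

definition cut :: "real \<Rightarrow> real" where "cut t = max 0 (min T t)"

lemma cut_in: "cut t \<in> {0..T}" and cut_eq: "t \<in> {0..T} \<Longrightarrow> cut t = t"
  using T_nonneg by (auto simp: cut_def)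

lemma continuous_on_cut: "continuous_on A cut"
  unfolding cut_def by (intro continuous_intros)

lemma continuous_on_S_cut: "continuous_on UNIV (\<lambda>p. S (cut (fst p)) (snd p))"
  unfolding continuous_on_sequentially
proof (intro ballI allI impI)
  fix p q assume "(\<forall>n. q n \<in> UNIV) \<and> q \<longlonglongrightarrow> (p :: real \<times> 'a)"
  then have q: "q \<longlonglongrightarrow> p" by simp
  have "(\<lambda>n. cut (fst (q n))) \<longlonglongrightarrow> cut (fst p)"
    using continuous_on_tendsto_compose[OF continuous_on_cut[of UNIV] tendsto_fst[OF q]] by simp
  then show "((\<lambda>p. S (cut (fst p)) (snd p)) \<circ> q) \<longlonglongrightarrow> S (cut (fst p)) (snd p)"
    unfolding o_def by (intro tendsto_S cut_in tendsto_snd[OF q])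
qed

text \<open>The arguments are cut off to \<open>[0,T]\<close> so that the integrand of the Duhamel integral becomes
  a function on the whole line that is jointly measurable and dominated independently of \<open>t\<close>.\<close>

definition duhamel_integrand :: "(real \<Rightarrow> 'a) \<Rightarrow> real \<Rightarrow> real \<Rightarrow> 'a" where
  "duhamel_integrand v t s = S (cut (t - s)) (indicator {0..T} s *\<^sub>R v s)"

lemma duhamel_integrand_eq:
  assumes "t \<in> {0..T}"
  shows "indicator {0..t} s *\<^sub>R S (t - s) (v s) = indicator {0..t} s *\<^sub>R duhamel_integrand v t s"
  using assms by (auto simp: duhamel_integrand_def indicator_def cut_eq)

lemma norm_duhamel_integrand: "norm (duhamel_integrand v t s) \<le> B * norm (indicator {0..T} s *\<^sub>R v s)"
  unfolding duhamel_integrand_def by (rule bound[OF cut_in])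

lemma measurable_duhamel_integrand:
  assumes v: "set_integrable lebesgue {0..T} v"
  shows "duhamel_integrand v t \<in> borel_measurable lebesgue"
proof -
  have "(\<lambda>s. indicator {0..T} s *\<^sub>R v s) \<in> borel_measurable lebesgue"
    using v unfolding set_integrable_def by (rule borel_measurable_integrable)
  moreover have "(\<lambda>s. t - s) \<in> borel_measurable lebesgue"
    by (rule measurable_completion) simp
  ultimately have "(\<lambda>s. (t - s, indicator {0..T} s *\<^sub>R v s)) \<in> borel_measurable lebesgue"
    by (rule borel_measurable_Pair[rotated])
  then have "(\<lambda>s. (\<lambda>p. S (cut (fst p)) (snd p)) (t - s, indicator {0..T} s *\<^sub>R v s)) \<in> borel_measurable lebesgue"
    by (rule measurable_compose) (rule borel_measurable_continuous_onI[OF continuous_on_S_cut])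
  then show ?thesis by (simp add: duhamel_integrand_def[abs_def])
qed

lemma integrable_dominating:
  fixes v :: "real \<Rightarrow> 'a"
  assumes v: "set_integrable lebesgue {0..T} v"
  shows "integrable lebesgue (\<lambda>s. B * norm (indicator {0..T} s *\<^sub>R v s))"
  by (rule integrable_mult_right[OF integrable_norm[OF v[unfolded set_integrable_def]]])

lemma set_integrable_duhamel:
  assumes v: "set_integrable lebesgue {0..T} v" and t: "t \<in> {0..T}"
  shows "set_integrable lebesgue {0..t} (\<lambda>s. S (t - s) (v s))"
proof -
  have "integrable lebesgue (duhamel_integrand v t)"
    by (rule Bochner_Integration.integrable_bound[OF integrable_dominating[OF v] measurable_duhamel_integrand[OF v]])
      (auto intro!: AE_I2 order_trans[OF norm_duhamel_integrand])
  then show ?thesis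
    unfolding set_integrable_def duhamel_integrand_eq[OF t]
    by (intro integrable_mult_indicator) simp_all
qed

lemma continuous_on_duhamel:
  assumes v: "set_integrable lebesgue {0..T} v"
  shows "continuous_on {0..T} (\<lambda>t. LINT s:{0..t}|lebesgue. S (t - s) (v s))"
  unfolding continuous_on_sequentially
proof (intro ballI allI impI)
  fix t r assume t: "t \<in> {0..T}" and "(\<forall>n. r n \<in> {0..T}) \<and> r \<longlonglongrightarrow> t"
  then have r: "\<And>n. r n \<in> {0..T}" and lim: "r \<longlonglongrightarrow> t" by auto
  have meas: "(\<lambda>s. indicator {0..q} s *\<^sub>R duhamel_integrand v q s) \<in> borel_measurable lebesgue" for q
    by (intro borel_measurable_scaleR borel_measurable_indicator measurable_duhamel_integrand v) simp
  have "(\<lambda>n. LINT s|lebesgue. indicator {0..r n} s *\<^sub>R duhamel_integrand v (r n) s)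
      \<longlonglongrightarrow> (LINT s|lebesgue. indicator {0..t} s *\<^sub>R duhamel_integrand v t s)"
  proof (rule integral_dominated_convergence[OF meas meas integrable_dominating[OF v]])
    show "AE s in lebesgue. norm (indicator {0..r n} s *\<^sub>R duhamel_integrand v (r n) s)
        \<le> B * norm (indicator {0..T} s *\<^sub>R v s)" for n
    proof (rule AE_I2)
      fix s
      show "norm (indicator {0..r n} s *\<^sub>R duhamel_integrand v (r n) s) \<le> B * norm (indicator {0..T} s *\<^sub>R v s)"
        using norm_duhamel_integrand[of v "r n" s] order_trans[OF norm_ge_zero norm_duhamel_integrand[of v "r n" s]]
        by (cases "s \<in> {0..r n}") auto
    qed
    \<comment> \<open>At \<open>s = t\<close> the indicators of \<open>{0..r n}\<close> need not
      converge; this point is a null set.\<close>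
    have "AE s in lebesgue. s \<noteq> t" by (rule AE_completion) (rule AE_lborel_singleton)
    then show "AE s in lebesgue. (\<lambda>n. indicator {0..r n} s *\<^sub>R duhamel_integrand v (r n) s)
        \<longlonglongrightarrow> indicator {0..t} s *\<^sub>R duhamel_integrand v t s"
    proof (rule AE_mp, intro AE_I2 impI)
      fix s assume "s \<noteq> t"
      have "(\<lambda>n. cut (r n - s)) \<longlonglongrightarrow> cut (t - s)"
        using continuous_on_tendsto_compose[OF continuous_on_cut[of UNIV], of "\<lambda>n. r n - s" "t - s"] lim
        by (simp add: tendsto_diff)
      then have "(\<lambda>n. duhamel_integrand v (r n) s) \<longlonglongrightarrow> duhamel_integrand v t s"
        unfolding duhamel_integrand_def by (intro tendsto_S cut_in tendsto_const)
      moreover have "(\<lambda>n. indicator {0..r n} s :: real) \<longlonglongrightarrow> indicator {0..t} s"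
      proof (cases "s < t")
        case True
        have "\<forall>\<^sub>F n in sequentially. s < r n" by (rule order_tendstoD(1)[OF lim True])
        then show ?thesis
          by (intro tendsto_eventually) (auto elim!: eventually_mono simp: indicator_def \<open>s < t\<close> less_imp_le)
      next
        case False
        then have "t < s" using \<open>s \<noteq> t\<close> by simp
        have "\<forall>\<^sub>F n in sequentially. r n < s" by (rule order_tendstoD(2)[OF lim \<open>t < s\<close>])
        then show ?thesis
          using \<open>t < s\<close> by (intro tendsto_eventually) (auto elim!: eventually_mono simp: indicator_def)
      qed
      ultimately show "(\<lambda>n. indicator {0..r n} s *\<^sub>R duhamel_integrand v (r n) s)
        \<longlonglongrightarrow> indicator {0..t} s *\<^sub>R duhamel_integrand v t s" by (rule tendsto_scaleR[rotated])
    qed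
  qed
  then show "((\<lambda>t. LINT s:{0..t}|lebesgue. S (t - s) (v s)) \<circ> r)
      \<longlonglongrightarrow> (LINT s:{0..t}|lebesgue. S (t - s) (v s))"
    unfolding o_def set_lebesgue_integral_def
    by (simp only: duhamel_integrand_eq[OF t] duhamel_integrand_eq[OF r])
qed

end

section \<open>Mild solutions of the semilinear equation\<close>

locale semilinear_equation = bounded_C0_semigroup S T B
  for S :: "real \<Rightarrow> 'a::{banach, second_countable_topology} \<Rightarrow> 'a" and T B :: real +
  fixes g :: "real \<Rightarrow> 'a \<Rightarrow> 'a" and k :: real
  assumes g_int: "\<And>x. continuous_on {0..T} x \<Longrightarrow> set_integrable lebesgue {0..T} (\<lambda>s. g s (x s))"
    and g_lip: "\<And>s x y. s \<in> {0..T} \<Longrightarrow> norm (g s x - g s y) \<le> k * norm (x - y)"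
    and k_nonneg: "k \<ge> 0"
begin

definition duhamel :: "(real \<Rightarrow> 'a) \<Rightarrow> real \<Rightarrow> 'a" where
  "duhamel x t = (LINT s:{0..t}|lebesgue. S (t - s) (g s (x s)))"

definition mild_solution :: "'a \<Rightarrow> (real \<Rightarrow> 'a) \<Rightarrow> bool" where
  "mild_solution x0 x \<longleftrightarrow> continuous_on {0..T} x \<and> (\<forall>t\<in>{0..T}. x t = S t x0 + duhamel x t)"

text \<open>The weight \<open>b\<close> is left open for two uses: the constant \<open>B\<close> in
  the contraction argument and \<open>M * exp (\<omega> * (t - s))\<close> in the stability
  estimate.\<close>

lemma norm_duhamel_diff_le:
  assumes x: "continuous_on {0..T} x" and y: "continuous_on {0..T} y" and t: "t \<in> {0..T}"
    and b: "continuous_on {0..t} b" "\<And>s z. s \<in> {0..t} \<Longrightarrow> norm (S (t - s) z) \<le> b s * norm z"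
      "\<And>s. s \<in> {0..t} \<Longrightarrow> b s \<ge> 0"
  shows "norm (duhamel x t - duhamel y t) \<le> integral {0..t} (\<lambda>s. b s * (k * norm (x s - y s)))"
proof -
  let ?D = "\<lambda>s. S (t - s) (g s (x s)) - S (t - s) (g s (y s))"
  let ?N = "\<lambda>s. b s * (k * norm (x s - y s))"
  have intx: "set_integrable lebesgue {0..t} (\<lambda>s. S (t - s) (g s (x s)))"
    and inty: "set_integrable lebesgue {0..t} (\<lambda>s. S (t - s) (g s (y s)))"
    using set_integrable_duhamel[OF g_int[OF x] t] set_integrable_duhamel[OF g_int[OF y] t] by auto
  have intD: "set_integrable lebesgue {0..t} ?D" using intx inty by (rule set_integral_diff)
  have "continuous_on {0..t} ?N"
    by (intro continuous_intros b continuous_on_subset[OF x] continuous_on_subset[OF y]) (use t in auto)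
  then have intN: "set_integrable lebesgue {0..t} ?N" by (rule absolutely_integrable_continuous_real)
  have "norm (duhamel x t - duhamel y t) = norm (LINT s:{0..t}|lebesgue. ?D s)"
    unfolding duhamel_def by (simp add: set_integral_diff(2)[OF intx inty])
  also have "\<dots> \<le> (LINT s:{0..t}|lebesgue. norm (?D s))" by (rule set_integral_norm_bound[OF intD])
  also have "\<dots> \<le> (LINT s:{0..t}|lebesgue. ?N s)"
  proof (rule set_integral_mono[OF set_integrable_norm[OF intD] intN])
    fix s assume s: "s \<in> {0..t}"
    then have "norm (?D s) \<le> b s * norm (g s (x s) - g s (y s))"
      using b(2)[OF s, of "g s (x s) - g s (y s)"] by (simp add: S_diff)
    also have "\<dots> \<le> ?N s" using s t by (intro mult_left_mono g_lip b) auto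
    finally show "norm (?D s) \<le> ?N s" .
  qed
  also have "\<dots> = integral {0..t} ?N" by (rule set_lebesgue_integral_eq_integral(2)[OF intN])
  finally show ?thesis .
qed

lemma mild_solution_stability:
  assumes x: "mild_solution x0 x" and y: "mild_solution y0 y"
    and M: "M \<ge> 0" "\<And>t z. t \<in> {0..T} \<Longrightarrow> norm (S t z) \<le> M * exp (\<omega> * t) * norm z"
    and t: "t \<in> {0..T}"
  shows "norm (x t - y t) \<le> M * exp ((\<omega> + M * k) * t) * norm (x0 - y0)"
proof -
  \<comment> \<open>The factor \<open>exp (- \<omega> * s)\<close> absorbs the growth of the
    semigroup, so Gronwall applies with rate \<open>M * k\<close>.\<close>
  define d where "d s = exp (- \<omega> * s) * norm (x s - y s)" for s
  have cx: "continuous_on {0..T} x" and cy: "continuous_on {0..T} y"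
    using x y by (auto simp: mild_solution_def)
  have "d t \<le> (M * norm (x0 - y0)) * exp ((M * k) * t)"
  proof (rule gronwall[OF _ _ _ t])
    show "continuous_on {0..T} d" unfolding d_def by (intro continuous_intros cx cy)
    show "M * k \<ge> 0" using M k_nonneg by simp
    fix t assume t: "t \<in> {0..T}"
    have "x t - y t = S t (x0 - y0) + (duhamel x t - duhamel y t)"
      using x y t by (simp add: mild_solution_def S_diff)
    then have "norm (x t - y t) \<le> norm (S t (x0 - y0)) + norm (duhamel x t - duhamel y t)"
      by (simp add: norm_triangle_ineq)
    also have "\<dots> \<le> M * exp (\<omega> * t) * norm (x0 - y0)
        + integral {0..t} (\<lambda>s. M * exp (\<omega> * (t - s)) * (k * norm (x s - y s)))"
      by (intro add_mono M(2) norm_duhamel_diff_le cx cy t continuous_intros)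
        (use M t in auto)
    also have "(\<lambda>s. M * exp (\<omega> * (t - s)) * (k * norm (x s - y s))) = (\<lambda>s. (exp (\<omega> * t) * (M * k)) * d s)"
      by (auto simp: d_def algebra_simps exp_diff exp_minus divide_simps)
    also have "integral {0..t} \<dots> = exp (\<omega> * t) * (M * k) * integral {0..t} d" by simp
    finally have "norm (x t - y t) \<le> exp (\<omega> * t) * (M * norm (x0 - y0) + M * k * integral {0..t} d)"
      by (simp add: algebra_simps)
    then show "d t \<le> M * norm (x0 - y0) + M * k * integral {0..t} d"
      unfolding d_def by (simp add: exp_minus field_simps)
  qed
  moreover have "norm (x t - y t) = exp (\<omega> * t) * d t" by (simp add: d_def exp_minus)
  ultimately have "norm (x t - y t) \<le> exp (\<omega> * t) * ((M * norm (x0 - y0)) * exp ((M * k) * t))"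
    by simp
  moreover have "exp ((\<omega> + M * k) * t) = exp (\<omega> * t) * exp ((M * k) * t)"
    by (simp add: distrib_right exp_add)
  ultimately show ?thesis by (simp only: mult_ac)
qed

lemma continuous_on_exp_mult_duhamel:
  assumes "continuous_on {0..T} x"
  shows "continuous_on {0..T} (\<lambda>t. exp (c * t) *\<^sub>R (S t x0 + duhamel x t))"
  unfolding duhamel_def
  by (intro continuous_intros continuous_on_orbit continuous_on_duhamel g_int assms)

lemma mild_solution_exists: "\<exists>x. mild_solution x0 x"
proof -
  \<comment> \<open>In the unknown \<open>exp (- c * t) *\<^sub>R x t\<close> (Bielecki's weight) the Picard map is a contraction
    on all of \<open>[0,T]\<close>.\<close>
  define c where "c = 2 * (B * k) + 1"
  \<comment> \<open>The second bound makes the constant \<open>B * k / c\<close> obtained below at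
    most \<open>1/2\<close>; the added 1 in \<open>c\<close> keeps it positive.\<close>
  have c: "c > 0" "2 * (B * k) \<le> c" using B_nonneg k_nonneg by (auto simp: c_def add_nonneg_pos)
  define E where "E z s = exp (c * s) *\<^sub>R apply_bcontfun z s" for z :: "real \<Rightarrow>\<^sub>C 'a" and s
  define \<Phi> where "\<Phi> z t = exp (- c * t) *\<^sub>R (S t x0 + duhamel (E z) t)" for z t
  \<comment> \<open>Composition with \<open>cut\<close> extends the Picard iterate to a bounded
    continuous function on the line, an element of a complete space.\<close>
  define \<Psi> where "\<Psi> z = Bcontfun (\<lambda>t. \<Phi> z (cut t))" for z
  have cE: "continuous_on {0..T} (E z)" for z unfolding E_def by (intro continuous_intros) auto
  have c\<Phi>: "continuous_on {0..T} (\<Phi> z)" for z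
    unfolding \<Phi>_def by (rule continuous_on_exp_mult_duhamel[OF cE])
  have "(\<lambda>t. \<Phi> z (cut t)) \<in> bcontfun" for z
  proof -
    have "continuous_on UNIV (\<lambda>t. \<Phi> z (cut t))"
      by (rule continuous_on_compose2[OF c\<Phi> continuous_on_cut]) (use cut_in in auto)
    moreover have "bounded (range (\<lambda>t. \<Phi> z (cut t)))"
      by (rule bounded_subset[OF compact_imp_bounded[OF compact_continuous_image[OF c\<Phi> compact_Icc]]])
        (use cut_in in auto)
    ultimately show ?thesis by (simp add: bcontfun_def)
  qed
  then have \<Psi>: "apply_bcontfun (\<Psi> z) = (\<lambda>t. \<Phi> z (cut t))" for z
    unfolding \<Psi>_def by (rule Bcontfun_inverse)
  have "\<exists>!z. \<Psi> z = z"
  proof (rule banach_fix_type[of "1/2"])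
    show "\<forall>z y. dist (\<Psi> z) (\<Psi> y) \<le> 1/2 * dist z y"
    proof (intro allI dist_bound)
      fix z y t
      let ?r = "cut t"
      have r: "?r \<in> {0..T}" by (rule cut_in)
      have "norm (duhamel (E z) ?r - duhamel (E y) ?r) \<le> integral {0..?r} (\<lambda>s. B * (k * norm (E z s - E y s)))"
        by (rule norm_duhamel_diff_le[OF cE cE r]) (use r bound B_nonneg in auto)
      also have "\<dots> \<le> integral {0..?r} (\<lambda>s. (B * k * dist z y) * exp (c * s))"
      proof (rule integral_le)
        show "(\<lambda>s. B * (k * norm (E z s - E y s))) integrable_on {0..?r}"
          by (intro integrable_continuous_interval continuous_intros continuous_on_subset[OF cE]) (use r in auto)
        show "(\<lambda>s. (B * k * dist z y) * exp (c * s)) integrable_on {0..?r}"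
          by (intro integrable_continuous_interval continuous_intros)
        fix s
        have "norm (E z s - E y s) = exp (c * s) * dist (z s) (y s)"
          unfolding E_def scaleR_diff_right[symmetric] by (simp add: dist_norm)
        also have "\<dots> \<le> exp (c * s) * dist z y" by (intro mult_left_mono dist_bounded) simp
        finally have "B * k * norm (E z s - E y s) \<le> B * k * (exp (c * s) * dist z y)"
          using B_nonneg k_nonneg by (intro mult_left_mono) auto
        then show "B * (k * norm (E z s - E y s)) \<le> (B * k * dist z y) * exp (c * s)"
          by (simp add: mult_ac)
      qed
      also have "\<dots> = (B * k * dist z y) * ((exp (c * ?r) - 1) / c)"
      proof -
        have "((\<lambda>s. exp (c * s)) has_integral exp (c * ?r) / c - exp (c * 0) / c) {0..?r}"
          by (rule fundamental_theorem_of_calculus)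
            (use r c in \<open>auto intro!: derivative_eq_intros simp flip: has_real_derivative_iff_has_vector_derivative\<close>)
        then have "integral {0..?r} (\<lambda>s. exp (c * s)) = (exp (c * ?r) - 1) / c"
          by (simp add: integral_unique diff_divide_distrib)
        then show ?thesis by simp
      qed
      \<comment> \<open>Integrating the weight gains the factor \<open>1 / c\<close>; the remaining
        exponential cancels against the one in \<open>\<Phi>\<close>.\<close>
      also have "\<dots> \<le> (B * k * dist z y) * (exp (c * ?r) / c)"
        using B_nonneg k_nonneg c by (intro mult_left_mono divide_right_mono) auto
      finally have *: "norm (duhamel (E z) ?r - duhamel (E y) ?r) \<le> (B * k * dist z y) * (exp (c * ?r) / c)" .
      have "dist (\<Psi> z t) (\<Psi> y t) = exp (- c * ?r) * norm (duhamel (E z) ?r - duhamel (E y) ?r)"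
        unfolding \<Psi> \<Phi>_def dist_norm scaleR_diff_right[symmetric] by simp
      also have "\<dots> \<le> exp (- c * ?r) * ((B * k * dist z y) * (exp (c * ?r) / c))"
        by (intro mult_left_mono *) simp
      also have "\<dots> = (B * k / c) * dist z y" by (simp add: exp_minus field_simps)
      also have "\<dots> \<le> 1/2 * dist z y"
        using c by (intro mult_right_mono) (auto simp: field_simps)
      finally show "dist (\<Psi> z t) (\<Psi> y t) \<le> 1/2 * dist z y" .
    qed
  qed auto
  then obtain z where "\<Psi> z = z" by blast
  have "E z t = S t x0 + duhamel (E z) t" if "t \<in> {0..T}" for t
  proof -
    have "apply_bcontfun z t = \<Phi> z t" using \<Psi>[of z] \<open>\<Psi> z = z\<close> cut_eq[OF that] by metis
    then have "E z t = exp (c * t) *\<^sub>R \<Phi> z t" by (simp only: E_def)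
    then show ?thesis by (simp add: \<Phi>_def exp_add[symmetric])
  qed
  with cE have "mild_solution x0 (E z)" by (auto simp: mild_solution_def)
  then show ?thesis by blast
qed

end

section \<open>The coupled problem\<close>

text \<open>The coincidence set is closed and contains almost every point of the open interval,
  hence all of it, hence its closure.\<close>

lemma AE_eq_imp_eq_on_Icc:
  fixes f g :: "real \<Rightarrow> 'a::real_normed_vector"
  assumes "a < b" and f: "continuous_on {a..b} f" and g: "continuous_on {a..b} g"
    and ae: "AE t in lebesgue_on {a<..<b}. f t = g t" and t: "t \<in> {a..b}"
  shows "f t = g t"
proof -
  let ?C = "{t \<in> {a..b}. f t - g t \<in> {0}}"
  have C: "closed ?C"
    using continuous_closed_preimage[of "{a..b}" "\<lambda>t. f t - g t" "{0}"] f g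
    by (auto simp: vimage_def Int_def intro: continuous_intros)
  have "AE t in lebesgue. t \<in> {a<..<b} \<longrightarrow> t \<in> ?C"
    using ae by (auto simp: AE_restrict_space_iff elim: AE_mp)
  then have "{a<..<b} \<subseteq> ?C"
    using mem_closed_if_AE_lebesgue_open[OF open_greaterThanLessThan C] by blast
  then have "closure {a<..<b} \<subseteq> ?C" using C by (rule closure_minimal)
  then have "t \<in> ?C" using t \<open>a < b\<close> by auto
  then show ?thesis by simp
qed

lemma C_norm_le:
  assumes "T \<ge> 0" "\<And>t. t \<in> {0..T} \<Longrightarrow> norm (v t) \<le> c"
  shows "C_norm T v \<le> c"
  unfolding C_norm_def using assms by (intro cSUP_least) auto

section \<open>Reduction to the semilinear equation\<close>

locale coupled_problem =
  parametric_vi T P K h m L\<^sub>F \<alpha>\<^sub>h + bounded_C0_semigroup S T B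
  for T :: real
    and P :: "'a::{real_inner, banach, second_countable_topology} \<Rightarrow> 'a"
    and K h m L\<^sub>F \<alpha>\<^sub>h
    and S :: "real \<Rightarrow> 'a \<Rightarrow> 'a" and B +
  fixes f :: "real \<Rightarrow> 'a \<Rightarrow> 'a \<Rightarrow> 'a" and \<alpha>\<^sub>f \<beta>\<^sub>f :: real
  assumes T_pos: "T > 0"
    and f_meas: "\<And>x u. (\<lambda>t. f t x u) \<in> borel_measurable (lebesgue_on {0..T})"
    and f_L1: "set_integrable lebesgue {0..T} (\<lambda>t. f t 0 0)"
    and f_consts: "\<alpha>\<^sub>f > 0" "\<beta>\<^sub>f > 0"
    and f_lip: "\<And>t x\<^sub>1 x\<^sub>2 u\<^sub>1 u\<^sub>2. t \<in> {0..T} \<Longrightarrow>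
                  norm (f t x\<^sub>1 u\<^sub>1 - f t x\<^sub>2 u\<^sub>2) \<le> \<alpha>\<^sub>f * norm (x\<^sub>1 - x\<^sub>2) + \<beta>\<^sub>f * norm (u\<^sub>1 - u\<^sub>2)"
begin

definition L :: real where "L = \<alpha>\<^sub>h * onorm (inv P) / m"

lemma L_nonneg: "L \<ge> 0"
  unfolding L_def using \<alpha>\<^sub>h_pos m_pos onorm_pos_le[OF coercive_bij(2)[OF P]] by simp

text \<open>Measurability comes from the Caratheodory composition on the pair of \<open>x\<close>
  and \<open>u\<close>, domination from the Lipschitz bound around \<open>f t 0 0\<close>.\<close>

lemma set_integrable_f:
  assumes x: "continuous_on {0..T} x" and u: "continuous_on {0..T} u"
  shows "set_integrable lebesgue {0..T} (\<lambda>t. f t (x t) (u t))"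
proof -
  let ?b = "\<lambda>t. norm (f t 0 0) + (\<alpha>\<^sub>f * norm (x t) + \<beta>\<^sub>f * norm (u t))"
  have cont: "continuous_on UNIV (\<lambda>z. f t (fst z) (snd z))" if t: "t \<in> {0..T}" for t
  proof (rule lipschitz_on_continuous_on)
    show "(\<alpha>\<^sub>f + \<beta>\<^sub>f)-lipschitz_on UNIV (\<lambda>z. f t (fst z) (snd z))"
    proof (rule lipschitz_onI)
      fix z w :: "'a \<times> 'a"
      have "norm (f t (fst z) (snd z) - f t (fst w) (snd w))
          \<le> \<alpha>\<^sub>f * norm (fst z - fst w) + \<beta>\<^sub>f * norm (snd z - snd w)"
        by (rule f_lip[OF t])
      also have "\<dots> \<le> \<alpha>\<^sub>f * dist z w + \<beta>\<^sub>f * dist z w"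
        using f_consts by (intro add_mono mult_left_mono)
          (simp_all add: dist_fst_le dist_snd_le flip: dist_norm)
      finally show "dist (f t (fst z) (snd z)) (f t (fst w) (snd w)) \<le> (\<alpha>\<^sub>f + \<beta>\<^sub>f) * dist z w"
        by (simp add: dist_norm algebra_simps)
    qed (use f_consts in simp)
  qed
  have "(\<lambda>t. f t (fst (x t, u t)) (snd (x t, u t))) \<in> borel_measurable (lebesgue_on {0..T})"
    by (rule measurable_caratheodory_compose[where G = "\<lambda>t z. f t (fst z) (snd z)"])
      (auto intro: f_meas cont continuous_on_Pair x u)
  then have meas: "set_borel_measurable lebesgue {0..T} (\<lambda>t. f t (x t) (u t))"
    by (simp add: set_borel_measurable_def borel_measurable_restrict_space_iff)
  have "set_integrable lebesgue {0..T} ?b"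
    by (intro set_integral_add set_integrable_norm f_L1 absolutely_integrable_continuous_real
        continuous_intros x u)
  moreover have "AE t in lebesgue. t \<in> {0..T} \<longrightarrow> norm (f t (x t) (u t)) \<le> norm (?b t)"
  proof (intro AE_I2 impI)
    fix t assume "t \<in> {0..T}"
    from f_lip[OF this, of "x t" "u t" 0 0] norm_triangle_sub[of "f t (x t) (u t)" "f t 0 0"] f_consts
    show "norm (f t (x t) (u t)) \<le> norm (?b t)" by simp
  qed
  ultimately show ?thesis by (rule set_integrable_bound[OF _ meas])
qed

text \<open>Inserting \<open>U s x\<close> eliminates the control; the resulting Lipschitz constant
  is the \<open>L'\<close> of the theorem.\<close>

sublocale semilinear_equation S T B "\<lambda>s x. f s x (U s x)" "\<alpha>\<^sub>f + \<beta>\<^sub>f * L"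
proof
  show "set_integrable lebesgue {0..T} (\<lambda>s. f s (x s) (U s (x s)))"
    if "continuous_on {0..T} x" for x :: "real \<Rightarrow> 'a"
    using that by (intro set_integrable_f continuous_on_U)
  show "norm (f s x (U s x) - f s y (U s y)) \<le> (\<alpha>\<^sub>f + \<beta>\<^sub>f * L) * norm (x - y)"
    if s: "s \<in> {0..T}" for s x y
  proof -
    have "norm (f s x (U s x) - f s y (U s y)) \<le> \<alpha>\<^sub>f * norm (x - y) + \<beta>\<^sub>f * norm (U s x - U s y)"
      by (rule f_lip[OF s])
    also have "\<dots> \<le> \<alpha>\<^sub>f * norm (x - y) + \<beta>\<^sub>f * (L * norm (x - y))"
      using norm_U_diff_le[OF s] f_consts by (intro add_left_mono mult_left_mono) (auto simp: L_def)
    finally show ?thesis by (simp add: algebra_simps)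
  qed
  show "0 \<le> \<alpha>\<^sub>f + \<beta>\<^sub>f * L" using f_consts L_nonneg by simp
qed

lemma mild_solution_cong:
  assumes eq: "\<And>t. t \<in> {0..T} \<Longrightarrow> x t = y t"
  shows "mild_solution x0 x \<longleftrightarrow> mild_solution x0 y"
proof -
  have "duhamel x t = duhamel y t" if "t \<in> {0..T}" for t
    unfolding duhamel_def using eq that by (intro set_lebesgue_integral_cong) auto
  moreover have "continuous_on {0..T} x \<longleftrightarrow> continuous_on {0..T} y"
    using eq by (intro continuous_on_cong) auto
  ultimately show ?thesis unfolding mild_solution_def using eq by auto
qed

text \<open>The inclusion gives \<open>u t = U t (x t)\<close> almost everywhere; both sides are
  continuous, so equality holds on all of \<open>[0,T]\<close>, and extensionality fixes
  \<open>u\<close> elsewhere.\<close>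

lemma mild_solution_pair_iff:
  "mild_solution_pair T S f h K P x0 (x, u) \<longleftrightarrow>
    x \<in> extensional {0..T} \<and> mild_solution x0 x \<and> u = restrict (\<lambda>t. U t (x t)) {0..T}"
  (is "?pair \<longleftrightarrow> ?sol")
proof -
  let ?Ux = "\<lambda>t. U t (x t)"
  have duhamel: "(LINT s:{0..t}|lebesgue. S (t - s) (f s (x s) (u s))) = duhamel x t"
    if "\<And>t. t \<in> {0..T} \<Longrightarrow> u t = ?Ux t" "t \<in> {0..T}" for t
    unfolding duhamel_def using that by (intro set_lebesgue_integral_cong) auto
  show ?thesis
  proof
    assume p: ?pair
    then have x: "x \<in> extensional {0..T}" "continuous_on {0..T} x"
      and u: "u \<in> extensional {0..T}" "continuous_on {0..T} u"
      and mild: "\<And>t. t \<in> {0..T} \<Longrightarrow>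
          x t = S t x0 + (LINT s:{0..t}|lebesgue. S (t - s) (f s (x s) (u s)))"
      and ae: "AE t in lebesgue_on {0<..<T}. u t \<in> {h t (x t) (u t) - \<xi> | \<xi>. \<xi> \<in> normal_cone (K t) (P (u t))}"
      by (auto simp: mild_solution_pair_def C_space_def)
    have "AE t in lebesgue_on {0<..<T}. u t = ?Ux t"
      using ae
    proof (rule AE_mp, intro AE_I2 impI)
      fix t assume "t \<in> space (lebesgue_on {0<..<T})"
        and "u t \<in> {h t (x t) (u t) - \<xi> | \<xi>. \<xi> \<in> normal_cone (K t) (P (u t))}"
      then show "u t = ?Ux t" by (subst (asm) inclusion_iff) auto
    qed
    then have eq: "u t = ?Ux t" if "t \<in> {0..T}" for t
      using AE_eq_imp_eq_on_Icc[OF T_pos u(2) continuous_on_U[OF x(2)] _ that] by blast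
    then have "u = restrict ?Ux {0..T}" using u(1) by (intro extensionalityI[of _ "{0..T}"]) auto
    moreover have "mild_solution x0 x"
      unfolding mild_solution_def using x(2) mild duhamel eq by simp
    ultimately show ?sol using x by simp
  next
    assume sol: ?sol
    then have x: "continuous_on {0..T} x" and eq: "\<And>t. t \<in> {0..T} \<Longrightarrow> u t = ?Ux t"
      by (auto simp: mild_solution_def)
    have u: "continuous_on {0..T} u"
      by (rule iffD2[OF continuous_on_cong[OF refl eq] continuous_on_U[OF x]])
    have "AE t in lebesgue_on {0<..<T}. u t \<in> {h t (x t) (u t) - \<xi> | \<xi>. \<xi> \<in> normal_cone (K t) (P (u t))}"
    proof (rule AE_I2)
      fix t assume "t \<in> space (lebesgue_on {0<..<T})"
      then have t: "t \<in> {0..T}" by simp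
      show "u t \<in> {h t (x t) (u t) - \<xi> | \<xi>. \<xi> \<in> normal_cone (K t) (P (u t))}"
        using inclusion_iff[OF t] eq[OF t] by blast
    qed
    moreover have "set_integrable lebesgue {0..t} (\<lambda>s. S (t - s) (f s (x s) (u s)))" if "t \<in> {0..T}" for t
      by (rule set_integrable_duhamel[OF set_integrable_f[OF x u] that])
    ultimately show ?pair
      using sol x u duhamel[OF eq] by (auto simp: mild_solution_pair_def C_space_def mild_solution_def)
  qed
qed

lemma ex1_mild_solution_pair: "\<exists>!p. mild_solution_pair T S f h K P x0 p"
proof (rule ex_ex1I)
  obtain x where "mild_solution x0 x" using mild_solution_exists by blast
  then have "mild_solution x0 (restrict x {0..T})"
    using mild_solution_cong[of "restrict x {0..T}" x] by simp
  then show "\<exists>p. mild_solution_pair T S f h K P x0 p" using mild_solution_pair_iff by fastforce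
next
  fix p q assume "mild_solution_pair T S f h K P x0 p" "mild_solution_pair T S f h K P x0 q"
  moreover obtain x u y v where pq: "p = (x, u)" "q = (y, v)" by (metis surj_pair)
  ultimately have sol: "x \<in> extensional {0..T}" "y \<in> extensional {0..T}"
    "mild_solution x0 x" "mild_solution x0 y"
    and uv: "u = restrict (\<lambda>t. U t (x t)) {0..T}" "v = restrict (\<lambda>t. U t (y t)) {0..T}"
    by (simp_all add: mild_solution_pair_iff)
  \<comment> \<open>Stability for equal data, with the bound \<open>B\<close> and exponent
    \<open>\<omega> = 0\<close>.\<close>
  have "norm (x t - y t) \<le> 0" if "t \<in> {0..T}" for t
    using mild_solution_stability[OF sol(3,4) B_nonneg, of 0 t] bound that by simp
  then have "x = y" using sol(1,2) by (intro extensionalityI[of _ "{0..T}"]) auto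
  then show "p = q" using pq uv by simp
qed

text \<open>The control difference is at most \<open>L\<close> times the bound for the state
  difference, whence the factor \<open>1 + L\<close>.\<close>

lemma CC_norm_diff_le:
  assumes p: "mild_solution_pair T S f h K P x0 p" and q: "mild_solution_pair T S f h K P y0 q"
    and M: "M \<ge> 0" "\<And>t z. t \<in> {0..T} \<Longrightarrow> norm (S t z) \<le> M * exp (\<omega> * t) * norm z"
  shows "CC_norm T (p - q)
    \<le> M * exp (max (\<omega> + M * (\<alpha>\<^sub>f + \<beta>\<^sub>f * L)) 0 * T) * (1 + L) * norm (x0 - y0)"
proof -
  let ?r = "\<omega> + M * (\<alpha>\<^sub>f + \<beta>\<^sub>f * L)"
  let ?c = "M * exp (max ?r 0 * T) * norm (x0 - y0)"
  obtain x u y v where pq: "p = (x, u)" "q = (y, v)" by (metis surj_pair)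
  then have sol: "mild_solution x0 x" "mild_solution y0 y"
    and uv: "u = restrict (\<lambda>t. U t (x t)) {0..T}" "v = restrict (\<lambda>t. U t (y t)) {0..T}"
    using p q by (simp_all add: mild_solution_pair_iff)
  have xy: "norm (x t - y t) \<le> ?c" if t: "t \<in> {0..T}" for t
  proof -
    \<comment> \<open>The positive part makes the exponent nondecreasing in \<open>t\<close>, so its
      value at \<open>T\<close> covers the whole interval.\<close>
    have "?r * t \<le> max ?r 0 * t" using t by (intro mult_right_mono) auto
    also have "\<dots> \<le> max ?r 0 * T" using t by (intro mult_left_mono) auto
    finally have "M * exp (?r * t) * norm (x0 - y0) \<le> ?c"
      using M(1) by (intro mult_right_mono mult_left_mono) auto
    then show ?thesis using mild_solution_stability[OF sol M t] by linarith
  qed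
  have "norm (u t - v t) \<le> L * ?c" if t: "t \<in> {0..T}" for t
  proof -
    have "norm (u t - v t) \<le> L * norm (x t - y t)"
      using norm_U_diff_le[OF t] t by (simp add: uv L_def)
    also have "\<dots> \<le> L * ?c" by (intro mult_left_mono xy t L_nonneg)
    finally show ?thesis .
  qed
  then have "C_norm T (x - y) \<le> ?c" "C_norm T (u - v) \<le> L * ?c"
    using xy T_pos by (auto intro!: C_norm_le)
  then show ?thesis by (simp add: pq CC_norm_def algebra_simps)
qed

end

theorem corollary5p3:
  fixes T :: real
    and D :: "'a::{real_inner, banach, second_countable_topology} set"
    and A :: "'a \<Rightarrow> 'a"
    and S :: "real \<Rightarrow> 'a \<Rightarrow> 'a"
    and P :: "'a \<Rightarrow> 'a"
    and K :: "real \<Rightarrow> 'a set"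
    and f h :: "real \<Rightarrow> 'a \<Rightarrow> 'a \<Rightarrow> 'a"
    and \<gamma> L\<^sub>F \<alpha>\<^sub>h \<alpha>\<^sub>f \<beta>\<^sub>f :: real
  assumes T_pos: "T > 0"
    and semigroup: "C0_semigroup S"
    and generator: "infinitesimal_generator D A S"
    and P: "bounded_linear P" "self_adjoint P" "coercive P"
    and K: "\<And>t. t \<in> {0..T} \<Longrightarrow> K t \<noteq> {} \<and> closed (K t) \<and> convex (K t)"
    and f_carath: "caratheodory T (\<lambda>t (x, u). f t x u)"
    and h_carath: "caratheodory T (\<lambda>t (x, u). h t x u)"
    and f_L1: "set_integrable lebesgue {0..T} (\<lambda>t. f t 0 0)"
    and F_consts: "\<gamma> > 0" "L\<^sub>F > 0"
    and F_pseudo: "\<And>t x. t \<in> {0..T} \<Longrightarrow> strongly_pseudomonotone_on (K t) (F_op P h t x) \<gamma>"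
    and F_lip: "\<And>t x. t \<in> {0..T} \<Longrightarrow> L\<^sub>F-lipschitz_on UNIV (F_op P h t x)"
    and \<alpha>\<^sub>h_pos: "\<alpha>\<^sub>h > 0"
    and h_lip: "\<And>t x\<^sub>1 x\<^sub>2 u. t \<in> {0..T} \<Longrightarrow>
                  norm (h t x\<^sub>1 u - h t x\<^sub>2 u) \<le> \<alpha>\<^sub>h * norm (x\<^sub>1 - x\<^sub>2)"
    and K_time: "time_regular_K T K"
    and h_time: "time_regular_h T h"
    and f_consts: "\<alpha>\<^sub>f > 0" "\<beta>\<^sub>f > 0"
    and f_lip: "\<And>t x\<^sub>1 x\<^sub>2 u\<^sub>1 u\<^sub>2. t \<in> {0..T} \<Longrightarrow>
                  norm (f t x\<^sub>1 u\<^sub>1 - f t x\<^sub>2 u\<^sub>2) \<le> \<alpha>\<^sub>f * norm (x\<^sub>1 - x\<^sub>2) + \<beta>\<^sub>f * norm (u\<^sub>1 - u\<^sub>2)"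
  shows "hadamard_well_posed (mild_solution_pair T S f h K P) (CC_norm T) \<and>
    (\<forall>x\<^sub>0. \<exists>!p. mild_solution_pair T S f h K P x\<^sub>0 p) \<and>
    (\<forall>M \<omega>. M \<ge> 1 \<and> (\<forall>t\<ge>0. onorm (S t) \<le> M * exp (\<omega> * t)) \<longrightarrow>
      (let G = solution_map (mild_solution_pair T S f h K P);
           L = \<alpha>\<^sub>h * onorm (inv P) / \<gamma>;
           L' = \<alpha>\<^sub>f + \<beta>\<^sub>f * L;
           C\<^sub>T = M * exp (max (\<omega> + M * L') 0 * T) * (1 + L)
       in \<forall>x\<^sub>0\<^sub>1 x\<^sub>0\<^sub>2. CC_norm T (G x\<^sub>0\<^sub>1 - G x\<^sub>0\<^sub>2) \<le> C\<^sub>T * norm (x\<^sub>0\<^sub>1 - x\<^sub>0\<^sub>2)))"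
proof -
  obtain B where B: "B \<ge> 1" "\<And>t x. t \<in> {0..T} \<Longrightarrow> norm (S t x) \<le> B * norm x"
    using C0_semigroup_bounded[OF semigroup, of T] by blast
  have f_meas: "(\<lambda>t. f t x u) \<in> borel_measurable (lebesgue_on {0..T})" for x u
    using f_carath unfolding caratheodory_def by (auto dest!: spec[of _ "(x, u)"])
  interpret coupled_problem T P K h \<gamma> L\<^sub>F \<alpha>\<^sub>h S B f \<alpha>\<^sub>f \<beta>\<^sub>f
    by (intro coupled_problem.intro parametric_vi.intro bounded_C0_semigroup.intro
        coupled_problem_axioms.intro)
      (assumption | rule assms f_meas B | use T_pos B(1) in linarith)+
  let ?Sol = "mild_solution_pair T S f h K P"
  let ?G = "solution_map ?Sol"
  have G: "?Sol x0 (?G x0)" for x0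
    unfolding solution_map_def by (rule theI'[OF ex1_mild_solution_pair])
  have lip: "CC_norm T (?G x0 - ?G y0)
      \<le> M * exp (max (\<omega> + M * (\<alpha>\<^sub>f + \<beta>\<^sub>f * L)) 0 * T) * (1 + L) * norm (x0 - y0)"
    if "M \<ge> 1" "\<And>t z. t \<in> {0..T} \<Longrightarrow> norm (S t z) \<le> M * exp (\<omega> * t) * norm z" for M \<omega> x0 y0
    by (rule CC_norm_diff_le[OF G G]) (use that in auto)
  have growth: "norm (S t z) \<le> M * exp (\<omega> * t) * norm z"
    if "\<forall>t\<ge>0. onorm (S t) \<le> M * exp (\<omega> * t)" "t \<in> {0..T}" for M \<omega> t z
  proof -
    have "norm (S t z) \<le> onorm (S t) * norm z" using that(2) by (intro onorm lin) auto
    also have "\<dots> \<le> M * exp (\<omega> * t) * norm z" using that by (intro mult_right_mono) auto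
    finally show ?thesis .
  qed
  \<comment> \<open>Continuity of the solution map follows from any one growth bound on
    \<open>[0,T]\<close>; \<open>B\<close> with \<open>\<omega> = 0\<close> is such a bound.\<close>
  define c where "c = B * exp (max (0 + B * (\<alpha>\<^sub>f + \<beta>\<^sub>f * L)) 0 * T) * (1 + L)"
  have "c > 0" unfolding c_def using B(1) L_nonneg by (intro mult_pos_pos) auto
  have "\<exists>\<delta>>0. \<forall>y0. norm (y0 - x0) < \<delta> \<longrightarrow> CC_norm T (?G y0 - ?G x0) < \<epsilon>" if "\<epsilon> > 0" for x0 \<epsilon>
  proof (intro exI[of _ "\<epsilon> / c"] conjI allI impI)
    show "\<epsilon> / c > 0" using that \<open>c > 0\<close> by simp
    fix y0 assume "norm (y0 - x0) < \<epsilon> / c"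
    then have "c * norm (y0 - x0) < \<epsilon>" using \<open>c > 0\<close> by (simp add: field_simps)
    moreover have "CC_norm T (?G y0 - ?G x0) \<le> c * norm (y0 - x0)"
      unfolding c_def by (rule lip) (use B in auto)
    ultimately show "CC_norm T (?G y0 - ?G x0) < \<epsilon>" by linarith
  qed
  then have "hadamard_well_posed ?Sol (CC_norm T)"
    unfolding hadamard_well_posed_def using ex1_mild_solution_pair by blast
  then show ?thesis
    using ex1_mild_solution_pair lip growth unfolding Let_def L_def by blast
qed

end
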